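(* Let $L$ be a valid skip list (as defined in the context) and let $B$ be a set of elements of $L$ (given by their bottom-level nodes). Suppose $\textsc{Split}(v)$ is invoked concurrently for all $v\in B$, with all memory instructions (reads, writes, compare-and-swaps) linearizable and no other operations running. Then every call terminates, and the resulting skip list is the same as the one obtained by performing $\textsc{Split}(v)$ for the elements $v\in B$ one after another sequentially, i.e., the valid skip list in which each sequence has been broken immediately after each element of $B$.
   Context: A skip list stores a collection of sequences (each possibly cyclic, i.e. its tail may be linked back to its head). Each element $x$ has a height $h\ge 1$ and one node $v_1,\dots,v_h$ per level; each node has four pointers left, right, up, down, with $v_i\to\mathrm{up}=v_{i+1}$, $v_i\to\mathrm{down}=v_{i-1}$ (null where undefined). In a valid skip list, at each level $i$ the nodes of elements of height at least $i$ form a doubly linked list in sequence order: $v_i\to\mathrm{right}$ is the level-$i$ node of the next element of its sequence having height $\ge i$, and $v_i\to\mathrm{left}$ is the level-$i$ node of the previous such element (null if none). Splitting a sequence at element $x$ separates it into the part up to and including $x$ and the part after $x$; splitting a cyclic sequence at $x$ turns it into a linear sequence whose last element is $x$. $\textsc{SearchLeft}(v)$: set $c=v$; while $c\to\mathrm{up}$ is null: set $c=c\to\mathrm{left}$, and if $c$ is null or $c=v$ return null; finally return $c\to\mathrm{up}$. $\textsc{Split}(v)$: let $g=v\to\mathrm{right}$; if $g$ is non-null and $\mathrm{CAS}(\&v\to\mathrm{right},g,\mathrm{null})$ succeeds, then set $g\to\mathrm{left}=\mathrm{null}$; let $p=\textsc{SearchLeft}(v)$; if $p$ is non-null, recursively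 call $\textsc{Split}(p)$. Here $\mathrm{CAS}(\&x,o,n)$ atomically sets location $x$ to $n$ if it currently holds $o$ and returns true, otherwise returns false. *)

theory Defs
  imports Main
begin

section \<open>Memory and skip lists\<close>

record 'n mem =
  left  :: "'n \<Rightarrow> 'n option"
  right :: "'n \<Rightarrow> 'n option"
  up    :: "'n \<Rightarrow> 'n option"
  down  :: "'n \<Rightarrow> 'n option"

text \<open>A cyclic sequence is given by any of its rotations.\<close>

datatype 'a seq = Linear (seq_list: "'a list") | Cyclic (seq_list: "'a list")

definition elements :: "'a seq set \<Rightarrow> 'a set" where
  "elements L = (\<Union>s\<in>L. set (seq_list s))"

text \<open>The level-\<open>i\<close> node of the element \<open>x\<close> is the pair \<open>(x, i)\<close>; levels start at 1.\<close>

type_synonym 'a node = "'a \<times> nat"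

definition level_nodes :: "('a \<Rightarrow> nat) \<Rightarrow> nat \<Rightarrow> 'a list \<Rightarrow> 'a node list" where
  "level_nodes h i xs = map (\<lambda>x. (x, i)) (filter (\<lambda>x. i \<le> h x) xs)"

definition linked_linear :: "'n mem \<Rightarrow> 'n list \<Rightarrow> bool" where
  "linked_linear m ns \<longleftrightarrow> (\<forall>k<length ns.
     right m (ns ! k) = (if Suc k < length ns then Some (ns ! Suc k) else None) \<and>
     left m (ns ! k) = (if 0 < k then Some (ns ! (k - 1)) else None))"

definition linked_cyclic :: "'n mem \<Rightarrow> 'n list \<Rightarrow> bool" where
  "linked_cyclic m ns \<longleftrightarrow> (\<forall>k<length ns.
     right m (ns ! k) = Some (ns ! (Suc k mod length ns)) \<and>
     left m (ns ! (Suc k mod length ns)) = Some (ns ! k))"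

fun linked_at_level :: "('a \<Rightarrow> nat) \<Rightarrow> 'a node mem \<Rightarrow> nat \<Rightarrow> 'a seq \<Rightarrow> bool" where
  "linked_at_level h m i (Linear xs) = linked_linear m (level_nodes h i xs)"
| "linked_at_level h m i (Cyclic xs) = linked_cyclic m (level_nodes h i xs)"

definition valid_skip_list :: "('a \<Rightarrow> nat) \<Rightarrow> 'a seq set \<Rightarrow> 'a node mem \<Rightarrow> bool" where
  "valid_skip_list h L m \<longleftrightarrow>
     finite L \<and>
     (\<forall>s\<in>L. distinct (seq_list s)) \<and>
     (\<forall>s\<in>L. \<forall>s'\<in>L. s \<noteq> s' \<longrightarrow> set (seq_list s) \<inter> set (seq_list s') = {}) \<and>
     (\<forall>x\<in>elements L. 1 \<le> h x) \<and>
     (\<forall>x\<in>elements L. \<forall>i\<in>{1..h x}.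
        up m (x, i) = (if i < h x then Some (x, i + 1) else None) \<and>
        down m (x, i) = (if 1 < i then Some (x, i - 1) else None)) \<and>
     (\<forall>s\<in>L. \<forall>i\<ge>1. linked_at_level h m i s)"


section \<open>Breaking sequences after the elements of a set\<close>

text \<open>\<open>chop B xs\<close> lists the maximal nonempty blocks of \<open>xs\<close> in which an element of \<open>B\<close> can only
  occur in last position.\<close>

fun chop :: "'a set \<Rightarrow> 'a list \<Rightarrow> 'a list list" where
  "chop B [] = []"
| "chop B (x # xs) =
     (if x \<in> B then [x] # chop B xs
      else case chop B xs of [] \<Rightarrow> [[x]] | p # ps \<Rightarrow> (x # p) # ps)"

text \<open>A cyclic sequence that meets \<open>B\<close> is first opened after one of its elements in \<open>B\<close>
  (the choice is immaterial): the rotation below ends in the first element of \<open>xs\<close> in \<open>B\<close>.\<close>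

fun break_seq :: "'a set \<Rightarrow> 'a seq \<Rightarrow> 'a seq set" where
  "break_seq B (Linear xs) = Linear ` set (chop B xs)"
| "break_seq B (Cyclic xs) =
     (if set xs \<inter> B = {} then {Cyclic xs}
      else Linear ` set (chop B (rotate (Suc (length (takeWhile (\<lambda>x. x \<notin> B) xs))) xs)))"

definition break_after :: "'a set \<Rightarrow> 'a seq set \<Rightarrow> 'a seq set" where
  "break_after B L = (\<Union>s\<in>L. break_seq B s)"

lemma chop_disjoint: "set xs \<inter> B = {} \<Longrightarrow> chop B xs = (if xs = [] then [] else [xs])"
  by (induction xs) auto

lemma chop_append: "set ys \<inter> B = {} \<Longrightarrow> x \<in> B \<Longrightarrow> chop B (ys @ x # zs) = (ys @ [x]) # chop B zs"
  by (induction ys) auto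

text \<open>For a single element, \<open>break_seq\<close> is the usual splitting of a sequence, an empty second part
  being dropped.\<close>

lemma break_seq_Linear_single:
  assumes "distinct (ys @ x # zs)"
  shows "break_seq {x} (Linear (ys @ x # zs)) =
    insert (Linear (ys @ [x])) (if zs = [] then {} else {Linear zs})"
  using assms by (simp add: chop_append chop_disjoint)

lemma break_seq_Cyclic_single:
  assumes "distinct (ys @ x # zs)"
  shows "break_seq {x} (Cyclic (ys @ x # zs)) = {Linear (zs @ ys @ [x])}"
proof -
  have "takeWhile (\<lambda>y. y \<notin> {x}) (ys @ x # zs) = ys"
    using assms by (subst takeWhile_append2) auto
  moreover have "rotate (Suc (length ys)) (ys @ x # zs) = (zs @ ys) @ x # []"
    using rotate_append[of "ys @ [x]" zs] by simp
  moreover have "chop {x} ((zs @ ys) @ x # []) = [(zs @ ys) @ [x]]"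
    using assms by (subst chop_append) auto
  ultimately show ?thesis by simp
qed


section \<open>The code of Split\<close>

text \<open>Control points of one call, each naming the memory instruction executed next, together with
  the values of the live local variables:
  \<^item> \<open>ReadRight v\<close>: \<open>g = v->right\<close>, the entry point of \<open>Split(v)\<close>;
  \<^item> \<open>CasRight v g\<close>: \<open>CAS(&v->right, g, null)\<close>;
  \<^item> \<open>ClearLeft v g\<close>: \<open>g->left = null\<close>;
  \<^item> \<open>TestUp v c\<close>: the loop test of \<open>SearchLeft(v)\<close>, entered with \<open>c = v\<close>;
  \<^item> \<open>ReadLeft v c\<close>: \<open>c = c->left\<close> in the loop body;
  \<^item> \<open>ReadUp v c\<close>: \<open>return c->up\<close>.

  The recursive call of Split is in tail position, so no call stack is needed: \<open>SearchLeft(v)\<close>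
  returning null ends the whole invocation, returning \<open>p\<close> continues at the entry point of
  \<open>Split(p)\<close>.\<close>

datatype 'n call =
    ReadRight 'n
  | CasRight 'n 'n
  | ClearLeft 'n 'n
  | TestUp 'n 'n
  | ReadLeft 'n 'n
  | ReadUp 'n 'n
  | Returned

fun exec :: "'n call \<Rightarrow> 'n mem \<Rightarrow> 'n call \<times> 'n mem" where
  "exec (ReadRight v) m =
     (case right m v of None \<Rightarrow> TestUp v v | Some g \<Rightarrow> CasRight v g, m)"
| "exec (CasRight v g) m =
     (if right m v = Some g then (ClearLeft v g, m\<lparr>right := (right m)(v := None)\<rparr>)
      else (TestUp v v, m))"
| "exec (ClearLeft v g) m = (TestUp v v, m\<lparr>left := (left m)(g := None)\<rparr>)"
| "exec (TestUp v c) m = (if up m c = None then ReadLeft v c else ReadUp v c, m)"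
| "exec (ReadLeft v c) m =
     (case left m c of None \<Rightarrow> Returned | Some d \<Rightarrow> if d = v then Returned else TestUp v d, m)"
| "exec (ReadUp v c) m = (case up m c of None \<Rightarrow> Returned | Some p \<Rightarrow> ReadRight p, m)"
| "exec Returned m = (Returned, m)"


section \<open>Sequential and concurrent execution\<close>

inductive solo_step :: "'n call \<times> 'n mem \<Rightarrow> 'n call \<times> 'n mem \<Rightarrow> bool" where
  "t \<noteq> Returned \<Longrightarrow> solo_step (t, m) (exec t m)"

definition split_result :: "'n \<Rightarrow> 'n mem \<Rightarrow> 'n mem \<Rightarrow> bool" where
  "split_result v m m' \<longleftrightarrow> solo_step\<^sup>*\<^sup>* (ReadRight v, m) (Returned, m')"

fun sequential_result :: "'n list \<Rightarrow> 'n mem \<Rightarrow> 'n mem \<Rightarrow> bool" where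
  "sequential_result [] m m' \<longleftrightarrow> m' = m"
| "sequential_result (v # vs) m m' \<longleftrightarrow>
     (\<exists>m1. split_result v m m1 \<and> sequential_result vs m1 m')"

text \<open>A configuration consists of the state of the call started at each node and the shared
  memory; nodes at which no call was invoked carry \<open>Returned\<close>. Linearizability of the memory
  instructions means that an execution is an arbitrary interleaving of atomic instructions.\<close>

type_synonym 'n config = "('n \<Rightarrow> 'n call) \<times> 'n mem"

definition initial :: "'n set \<Rightarrow> 'n mem \<Rightarrow> 'n config" where
  "initial V m = (\<lambda>v. if v \<in> V then ReadRight v else Returned, m)"

inductive conc_step :: "'n config \<Rightarrow> 'n config \<Rightarrow> bool" where
  "T v \<noteq> Returned \<Longrightarrow> exec (T v) m = (t', m') \<Longrightarrow> conc_step (T, m) (T(v := t'), m')"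

end

theory Submission
  imports Defs
begin

text \<open>Right and left pointers only ever change to null, and only those at a node of a fixed set
  \<open>Cut\<close>, computed on the initial memory, change: the starting nodes, closed under walking left to
  the first node that has an upper copy and moving up. Conversely every node of \<open>Cut\<close> gets cut. A
  search that is stopped by a nulled left pointer was stopped by a cut that another call made
  strictly closer to the common parent, and that call, or one that stopped it in turn, still has to
  reach the parent. Hence every complete interleaving ends in the same memory, determined by
  \<open>Cut\<close>; sequential execution is one of the interleavings. Each call walks left at most once around
  a level and then moves up, so executions are finite.\<close>

section \<open>Concurrent splits on an abstract linked memory\<close>

text \<open>The concurrent argument rests on a finite set of nodes where left and right links are
  mutually inverse and keep the level, while up links raise it. Sequences and heights enter later,
  to recognise \<open>cut_memory\<close> as the memory of the broken sequences. \<open>Cut\<close>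
  is defined by walks without the test \<open>c = v\<close> of the code. This loses nothing: walking
  left is deterministic and stops at a node with an upper copy, so a walk that reaches such a node
  never repeats a node. Walks that go round for ever climb nowhere. The recognition needs a
  description of \<open>Cut\<close> without searches: if \<open>x\<close> has height at least
  \<open>i\<close>, then \<open>(x, i)\<close> is in \<open>Cut\<close> exactly when an element of
  \<open>B\<close> lies between \<open>x\<close> (included) and the next element of height at least
  \<open>i\<close> (excluded), that is, when the level-\<open>i\<close> link leaving
  \<open>x\<close> passes over a break.\<close>

locale split_memory =
  fixes m0 :: "'n mem" and N V :: "'n set" and lev :: "'n \<Rightarrow> nat"
  assumes finite_N: "finite N"
    and V_N: "V \<subseteq> N"
    and right_N: "\<lbrakk>u \<in> N; right m0 u = Some w\<rbrakk> \<Longrightarrow> w \<in> N \<and> left m0 w = Some u"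
    and left_N: "\<lbrakk>w \<in> N; left m0 w = Some u\<rbrakk> \<Longrightarrow> u \<in> N \<and> right m0 u = Some w \<and> lev u = lev w"
    and up_N: "\<lbrakk>u \<in> N; up m0 u = Some p\<rbrakk> \<Longrightarrow> p \<in> N \<and> lev u < lev p"
begin

text \<open>One round of the search loop on the initial memory, without the test for being back at
  the start; \<open>search_hop\<close> adds that test.\<close>

definition hop :: "'n \<Rightarrow> 'n \<Rightarrow> bool" where
  "hop c d \<longleftrightarrow> up m0 c = None \<and> left m0 c = Some d"

definition search_hop :: "'n \<Rightarrow> 'n \<Rightarrow> 'n \<Rightarrow> bool" where
  "search_hop v c d \<longleftrightarrow> hop c d \<and> d \<noteq> v"

text \<open>The nodes at which Split is called when no search is cut short.\<close>

inductive_set Cut :: "'n set" where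
  start: "v \<in> V \<Longrightarrow> v \<in> Cut"
| climb: "\<lbrakk>u \<in> Cut; hop\<^sup>*\<^sup>* u c; up m0 c = Some p\<rbrakk> \<Longrightarrow> p \<in> Cut"

definition cut_memory :: "'n mem" where
  "cut_memory = m0\<lparr>right := \<lambda>u. if u \<in> Cut then None else right m0 u,
     left := \<lambda>w. if \<exists>u\<in>Cut. right m0 u = Some w then None else left m0 w\<rparr>"

section \<open>Walks to the left on the initial memory\<close>

lemma hop_det: "hop c d \<Longrightarrow> hop c d' \<Longrightarrow> d = d'"
  by (simp add: hop_def)

text \<open>No hop starts at a node with an upper copy, so by determinism everything reached from
  \<open>u\<close> lies on the one walk that ends in \<open>f\<close>.\<close>

lemma hops_from:
  assumes "hop\<^sup>*\<^sup>* u c" "hop\<^sup>*\<^sup>* u f" "up m0 f = Some p"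
  shows "hop\<^sup>*\<^sup>* c f"
  using assms
proof (induction rule: converse_rtranclp_induct)
  case (step x y)
  have "x \<noteq> f" using step by (auto simp: hop_def)
  then obtain z where "hop x z" "hop\<^sup>*\<^sup>* z f" using step.prems(1) by (auto elim: converse_rtranclpE)
  then show ?case using step hop_det by blast
qed auto

text \<open>In a deterministic walk, a cycle through one node also passes through the next one. It
  could thus be pushed forward to \<open>f\<close>, where no hop starts.\<close>

lemma hops_acyclic:
  assumes "hop\<^sup>*\<^sup>* c f" "up m0 f = Some p"
  shows "\<not> hop\<^sup>+\<^sup>+ c c"
  using assms
proof (induction rule: converse_rtranclp_induct)
  case base
  then show ?case by (auto simp: hop_def dest: tranclpD)
next
  case (step x y)
  show ?case
  proof
    assume "hop\<^sup>+\<^sup>+ x x"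
    then obtain z where "hop x z" "hop\<^sup>*\<^sup>* z x" by (auto dest: tranclpD)
    then have "hop\<^sup>+\<^sup>+ y y" using step.hyps(1) hop_det
      by (metis rtranclp_into_tranclp1)
    then show False using step by blast
  qed
qed

lemma parent_unique:
  assumes "hop\<^sup>*\<^sup>* u c" "up m0 c = Some p" "hop\<^sup>*\<^sup>* u d" "up m0 d = Some q"
  shows "p = q"
proof -
  have "hop\<^sup>*\<^sup>* c d" using assms hops_from by blast
  then have "c = d" using assms(2) by (metis converse_rtranclpE hop_def option.distinct(1))
  then show ?thesis using assms by simp
qed

lemma search_hops_hops: "(search_hop v)\<^sup>*\<^sup>* c d \<Longrightarrow> hop\<^sup>*\<^sup>* c d"
  by (erule rtranclp_mono[THEN predicate2D, rotated]) (auto simp: search_hop_def)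

lemma hops_N: "hop\<^sup>*\<^sup>* u c \<Longrightarrow> u \<in> N \<Longrightarrow> c \<in> N \<and> lev c = lev u"
  by (induction rule: rtranclp_induct) (use left_N in \<open>auto simp: hop_def\<close>)

lemma Cut_N: "u \<in> Cut \<Longrightarrow> u \<in> N"
  by (induction rule: Cut.induct) (use V_N up_N hops_N in blast)+

section \<open>Safety and progress\<close>

text \<open>Local variables are described in terms of \<open>m0\<close> only, so no step of another
  call can invalidate this.\<close>

fun ok_call :: "'n call \<Rightarrow> bool" where
  "ok_call (ReadRight v) \<longleftrightarrow> v \<in> Cut"
| "ok_call (CasRight v g) \<longleftrightarrow> v \<in> Cut \<and> right m0 v = Some g"
| "ok_call (ClearLeft v g) \<longleftrightarrow> v \<in> Cut \<and> right m0 v = Some g"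
| "ok_call (TestUp v c) \<longleftrightarrow> v \<in> Cut \<and> (search_hop v)\<^sup>*\<^sup>* v c"
| "ok_call (ReadLeft v c) \<longleftrightarrow> v \<in> Cut \<and> (search_hop v)\<^sup>*\<^sup>* v c \<and> up m0 c = None"
| "ok_call (ReadUp v c) \<longleftrightarrow> v \<in> Cut \<and> (search_hop v)\<^sup>*\<^sup>* v c \<and> up m0 c \<noteq> None"
| "ok_call Returned \<longleftrightarrow> True"

text \<open>Ends with the CAS, whether it succeeds or fails: from then on the right pointer of
  \<open>u\<close> is known to be null.\<close>

fun pending :: "'n call \<Rightarrow> 'n \<Rightarrow> bool" where
  "pending (ReadRight v) u \<longleftrightarrow> v = u"
| "pending (CasRight v g) u \<longleftrightarrow> v = u"
| "pending _ _ \<longleftrightarrow> False"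

text \<open>\<open>ClearLeft v g\<close> counts as a search at \<open>v\<close>, because that is
  where the search starts right after it.\<close>

fun search_at :: "'n call \<Rightarrow> 'n \<Rightarrow> bool" where
  "search_at (ClearLeft v g) d \<longleftrightarrow> v = d"
| "search_at (TestUp v c) d \<longleftrightarrow> c = d"
| "search_at (ReadLeft v c) d \<longleftrightarrow> c = d"
| "search_at (ReadUp v c) d \<longleftrightarrow> c = d"
| "search_at _ _ \<longleftrightarrow> False"

text \<open>The second alternative leaves \<open>p\<close> out: by \<open>parent_unique\<close>, a
  search standing on the walk from \<open>u\<close> can climb to no other node than the parent of
  \<open>u\<close>.\<close>

definition serves :: "'n call \<Rightarrow> 'n \<Rightarrow> 'n \<Rightarrow> bool" where
  "serves t u p \<longleftrightarrow> pending t p \<or> (\<exists>d. search_at t d \<and> hop\<^sup>*\<^sup>* u d)"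

text \<open>The last clause assigns each half-cut link to a call that is about to clear its other
  half. Once no such call is left, both halves are null.\<close>

definition safe :: "('n \<Rightarrow> 'n call) \<Rightarrow> 'n mem \<Rightarrow> bool" where
  "safe T m \<longleftrightarrow>
     up m = up m0 \<and> down m = down m0 \<and>
     (\<forall>t. ok_call (T t)) \<and> (\<forall>t. t \<notin> V \<longrightarrow> T t = Returned) \<and>
     (\<forall>u. right m u = right m0 u \<or> right m u = None \<and> u \<in> Cut) \<and>
     (\<forall>w. left m w = left m0 w \<or> left m w = None \<and> (\<exists>u\<in>Cut. right m0 u = Some w)) \<and>
     (\<forall>u w. u \<in> Cut \<and> right m0 u = Some w \<and> right m u = None \<longrightarrow>
        left m w = None \<or> (\<exists>t. T t = ClearLeft u w))"

text \<open>The ghost set \<open>A\<close> collects the nodes whose right pointer some call has found or made null.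
  A call serving the climb from \<open>u\<close> to \<open>p\<close> must stand at or to the left of \<open>u\<close>: this is what
  keeps two calls stopped by each other's cuts from each relying on the other.\<close>

definition covered :: "'n set \<Rightarrow> ('n \<Rightarrow> 'n call) \<Rightarrow> 'n mem \<Rightarrow> bool" where
  "covered A T m \<longleftrightarrow>
     (\<forall>u\<in>A. right m u = None) \<and>
     (\<forall>t v g. T t = ClearLeft v g \<longrightarrow> v \<in> A) \<and>
     (\<forall>w u. left m0 w = Some u \<and> left m w = None \<longrightarrow> u \<in> A) \<and>
     (\<forall>v\<in>V. v \<in> A \<or> (\<exists>t. pending (T t) v)) \<and>
     (\<forall>u\<in>A. \<forall>c p. hop\<^sup>*\<^sup>* u c \<and> up m0 c = Some p \<longrightarrow> p \<in> A \<or> (\<exists>t. serves (T t) u p))"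

text \<open>Which null pointers have been noticed is a matter of history that the configuration does
  not record, hence the existential \<open>A\<close>.\<close>

definition invariant :: "'n config \<Rightarrow> bool" where
  "invariant = (\<lambda>(T, m). safe T m \<and> (\<exists>A. covered A T m))"

lemma invariant_initial: "invariant (initial V m0)"
proof -
  have "safe (\<lambda>v. if v \<in> V then ReadRight v else Returned) m0"
    using Cut.start Cut_N right_N by (auto simp: safe_def)
  moreover have "covered {} (\<lambda>v. if v \<in> V then ReadRight v else Returned) m0"
    unfolding covered_def by (auto intro: exI[where P = "\<lambda>t. pending (if t \<in> V then _ t else _) _"])
  ultimately show ?thesis by (auto simp: invariant_def initial_def)
qed

text \<open>A left or right pointer is either null or has its initial value. A non-null value read
  now is therefore the one that \<open>ok_call\<close> records.\<close>

lemma safe_step: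
  assumes "safe T m" "exec (T v) m = (t', m')" "T v \<noteq> Returned"
  shows "safe (T(v := t')) m'"
proof -
  have upm: "up m = up m0" "down m = down m0"
    and ok: "\<And>t. ok_call (T t)" and V: "\<And>t. t \<notin> V \<Longrightarrow> T t = Returned"
    and r: "\<And>u. right m u = right m0 u \<or> right m u = None \<and> u \<in> Cut"
    and l: "\<And>w. left m w = left m0 w \<or> left m w = None \<and> (\<exists>u\<in>Cut. right m0 u = Some w)"
    and rl: "\<And>u w. \<lbrakk>u \<in> Cut; right m0 u = Some w; right m u = None\<rbrakk> \<Longrightarrow>
        left m w = None \<or> (\<exists>t. T t = ClearLeft u w)"
    using assms(1) unfolding safe_def by auto
  have "v \<in> V" using V assms(3) by blast
  have m': "up m' = up m0" "down m' = down m0"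
    using assms(2) upm by (cases "T v"; auto split: option.splits if_splits)+
  have ok': "ok_call t'"
  proof (cases "T v")
    case (ReadRight u)
    then show ?thesis using assms(2) ok[of v] r[of u] by (auto split: option.splits)
  next
    case (ReadLeft u c)
    have "(search_hop u)\<^sup>*\<^sup>* u d" if "left m c = Some d" "d \<noteq> u" for d
    proof -
      have "search_hop u c d" using that ok[of v] ReadLeft l[of c]
        by (auto simp: search_hop_def hop_def)
      then show ?thesis using ok[of v] ReadLeft by (auto intro: rtranclp.rtrancl_into_rtrancl)
    qed
    then show ?thesis using assms(2) ok[of v] ReadLeft by (auto split: option.splits if_splits)
  next
    case (ReadUp u c)
    then have "u \<in> Cut" "hop\<^sup>*\<^sup>* u c" using ok[of v] search_hops_hops by auto
    then show ?thesis using assms(2) ReadUp upm by (auto split: option.splits intro: Cut.climb)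
  qed (use assms(2) ok[of v] upm in \<open>auto split: if_splits\<close>)
  have r': "right m' u = right m0 u \<or> right m' u = None \<and> u \<in> Cut" for u
    using assms(2) r[of u] ok[of v] by (cases "T v") (auto split: option.splits if_splits)
  have l': "left m' w = left m0 w \<or> left m' w = None \<and> (\<exists>u\<in>Cut. right m0 u = Some w)" for w
    using assms(2) l[of w] ok[of v] by (cases "T v") (auto split: option.splits if_splits)
  have rl': "left m' w = None \<or> (\<exists>t. (T(v := t')) t = ClearLeft u w)"
    if u: "u \<in> Cut" "right m0 u = Some w" "right m' u = None" for u w
  proof (cases "right m u = None")
    case False
    \<comment> \<open>Only a successful CAS nulls a right pointer, and its call then becomes the one
      that still has to clear \<open>w\<close>.\<close>
    then have "t' = ClearLeft u w" using u assms(2) ok[of v]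
      by (cases "T v") (auto split: option.splits if_splits)
    then show ?thesis by auto
  next
    case True
    have "left m' w = None" if "left m w = None"
      using that assms(2) by (cases "T v") (auto split: option.splits if_splits)
    moreover have "left m' w = None \<or> (T(v := t')) t = ClearLeft u w" if "T t = ClearLeft u w" for t
      using that assms(2) by (cases "t = v") auto
    ultimately show ?thesis using rl[OF u(1,2) True] by metis
  qed
  show ?thesis
    unfolding safe_def using m' ok ok' V \<open>v \<in> V\<close> r' l' rl' by auto
qed

text \<open>Frame rule for a step of the call started at \<open>v\<close>: other calls keep what
  they serve, so only the duties of this call have to be passed on (\<open>pend\<close>,
  \<open>srch\<close>), and nodes that enter the ghost set must be served by its new state
  (\<open>new\<close>).\<close>

lemma covered_handover:
  assumes A: "covered A T m" and sub: "A \<subseteq> A'"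
    and null: "\<And>u. u \<in> A' \<Longrightarrow> right m' u = None"
    and clear: "\<And>u g. t' = ClearLeft u g \<Longrightarrow> u \<in> A'"
    and left: "\<And>w u. left m0 w = Some u \<Longrightarrow> left m' w = None \<Longrightarrow> left m w = None \<or> u \<in> A'"
    and pend: "\<And>p. pending (T v) p \<Longrightarrow> p \<in> A' \<or> pending t' p"
    and srch: "\<And>u c p d. \<lbrakk>u \<in> A; hop\<^sup>*\<^sup>* u c; up m0 c = Some p; search_at (T v) d; hop\<^sup>*\<^sup>* u d\<rbrakk>
      \<Longrightarrow> p \<in> A \<or> (\<exists>t. t \<noteq> v \<and> serves (T t) u p) \<or> serves t' u p"
    and new: "\<And>u p. u \<in> A' \<Longrightarrow> u \<notin> A \<Longrightarrow> serves t' u p"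
  shows "covered A' (T(v := t')) m'"
proof -
  have "\<exists>t. pending ((T(v := t')) t) x" if x: "x \<in> V" "x \<notin> A'" for x
  proof -
    obtain t where "pending (T t) x" using A x sub unfolding covered_def by blast
    then show ?thesis using pend x by (metis fun_upd_other fun_upd_same)
  qed
  moreover have "\<exists>t. serves ((T(v := t')) t) u p"
    if u: "u \<in> A'" "hop\<^sup>*\<^sup>* u c" "up m0 c = Some p" "p \<notin> A'" for u c p
  proof (cases "u \<in> A")
    case True
    then obtain t where t: "serves (T t) u p" using A u sub unfolding covered_def by blast
    have "(\<exists>t. t \<noteq> v \<and> serves (T t) u p) \<or> serves t' u p"
    proof (cases "t = v")
      case True
      then show ?thesis using t pend u sub srch[OF \<open>u \<in> A\<close> u(2,3)] by (auto simp: serves_def)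
    qed (use t in blast)
    then show ?thesis by (metis fun_upd_other fun_upd_same)
  next
    case False
    then have "serves t' u p" using new u by blast
    then show ?thesis by (metis fun_upd_same)
  qed
  moreover have "\<forall>t x g. (T(v := t')) t = ClearLeft x g \<longrightarrow> x \<in> A'"
    using A clear sub unfolding covered_def by (metis fun_upd_apply subsetD)
  moreover have "\<forall>w u. left m0 w = Some u \<and> left m' w = None \<longrightarrow> u \<in> A'"
    using A left sub unfolding covered_def by blast
  ultimately show ?thesis unfolding covered_def using null by blast
qed

lemma covered_step:
  assumes "safe T m" "covered A T m" "exec (T v) m = (t', m')" "T v \<noteq> Returned"
  shows "\<exists>A'. covered A' (T(v := t')) m'"
proof -
  have upm: "up m = up m0" and ok: "ok_call (T v)"
    and r: "\<And>u. right m u = right m0 u \<or> right m u = None \<and> u \<in> Cut"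
    and l: "\<And>w. left m w = left m0 w \<or> left m w = None"
    using assms(1) unfolding safe_def by auto
  have null: "\<And>u. u \<in> A \<Longrightarrow> right m u = None"
    and clear: "\<And>t x g. T t = ClearLeft x g \<Longrightarrow> x \<in> A"
    and left: "\<And>w u. left m0 w = Some u \<Longrightarrow> left m w = None \<Longrightarrow> u \<in> A"
    and climb: "\<And>u c p. \<lbrakk>u \<in> A; hop\<^sup>*\<^sup>* u c; up m0 c = Some p\<rbrakk> \<Longrightarrow> p \<in> A \<or> (\<exists>t. serves (T t) u p)"
    using assms(2) unfolding covered_def by auto
  show ?thesis
  proof (cases "T v")
    case (ReadRight u)
    show ?thesis
    proof (cases "right m u")
      case None
      have "covered (insert u A) (T(v := t')) m'"
        by (rule covered_handover[OF assms(2)])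
          (use ReadRight None assms(3) null in \<open>auto simp: serves_def\<close>)
      then show ?thesis by blast
    next
      case (Some g)
      have "covered A (T(v := t')) m'"
        by (rule covered_handover[OF assms(2)])
          (use ReadRight Some assms(3) null in \<open>auto simp: serves_def\<close>)
      then show ?thesis by blast
    qed
  next
    case (CasRight u g)
    have "covered (insert u A) (T(v := t')) m'"
    proof (rule covered_handover[OF assms(2)])
      \<comment> \<open>A failed CAS also finds null at \<open>u\<close>, since the only other
        possible value is the expected \<open>Some g\<close>.\<close>
      show "right m' x = None" if "x \<in> insert u A" for x
        using that CasRight assms(3) null r[of u] ok by (auto split: if_splits)
    qed (use CasRight assms(3) in \<open>auto simp: serves_def split: if_splits\<close>)
    then show ?thesis by blast
  next
    case (ClearLeft u g)
    \<comment> \<open>The pointer being nulled led to \<open>u\<close>, and \<open>u\<close> is in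
      \<open>A\<close> because its call has reached \<open>ClearLeft\<close>.\<close>
    have "left m0 g = Some u" using ok ClearLeft Cut_N right_N by auto
    then have "covered A (T(v := t')) m'"
      by (intro covered_handover[OF assms(2)])
        (use ClearLeft assms(3) null clear[of v] in \<open>auto simp: serves_def split: if_splits\<close>)
    then show ?thesis by blast
  next
    case (TestUp u c)
    have "covered A (T(v := t')) m'"
      by (rule covered_handover[OF assms(2)])
        (use TestUp assms(3) null in \<open>auto simp: serves_def split: if_splits\<close>)
    then show ?thesis by blast
  next
    case (ReadLeft x c)
    have c: "up m0 c = None" and xc: "hop\<^sup>*\<^sup>* x c" using ok ReadLeft search_hops_hops by auto
    have t': "m' = m" "t' = (case left m c of None \<Rightarrow> Returned | Some d \<Rightarrow> if d = x then Returned else TestUp x d)"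
      using assms(3) ReadLeft by auto
    have "covered A (T(v := t')) m'"
    proof (rule covered_handover[OF assms(2)])
      fix u f p d
      assume u: "u \<in> A" "hop\<^sup>*\<^sup>* u f" "up m0 f = Some p" "search_at (T v) d" "hop\<^sup>*\<^sup>* u d"
      then have uc: "hop\<^sup>*\<^sup>* u c" using ReadLeft by simp
      then have "hop\<^sup>*\<^sup>* c f" using hops_from u by blast
      then obtain e where e: "hop c e" "hop\<^sup>*\<^sup>* e f" using c u(3)
        by (metis converse_rtranclpE option.distinct(1))
      have ue: "hop\<^sup>*\<^sup>* u e" using uc e by simp
      have "\<not> hop\<^sup>+\<^sup>+ c c" using hops_acyclic \<open>hop\<^sup>*\<^sup>* c f\<close> u by blast
      then have ec: "\<not> hop\<^sup>*\<^sup>* e c" using e by (meson rtranclp_into_tranclp2)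
      show "p \<in> A \<or> (\<exists>t. t \<noteq> v \<and> serves (T t) u p) \<or> serves t' u p"
      proof (cases "left m c")
        case None
        \<comment> \<open>The link from \<open>c\<close> to \<open>e\<close> has been cut, so
          \<open>e\<close> has its own climb to the same parent \<open>p\<close>, and whoever serves
          \<open>e\<close> also serves \<open>u\<close>.\<close>
        then have "e \<in> A" using left e by (auto simp: hop_def)
        from climb[OF this e(2) u(3)] show ?thesis
        proof
          assume "\<exists>t. serves (T t) e p"
          then obtain t where t: "serves (T t) e p" by blast
          \<comment> \<open>A search serving \<open>e\<close> stands at \<open>e\<close> or further
            along the walk, never back at \<open>c\<close>; so the stopped call cannot be its own
            replacement.\<close>
          then have "t \<noteq> v" using ReadLeft ec by (auto simp: serves_def)
          moreover have "serves (T t) u p" using t ue by (auto simp: serves_def)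
          ultimately show ?thesis by blast
        qed blast
      next
        case (Some d')
        then have "d' = e" using l[of c] e by (auto simp: hop_def)
        \<comment> \<open>If \<open>e\<close> were the start of this search, the walk from
          \<open>x\<close> to \<open>c\<close> would close a cycle. The search is therefore not
          ended by the wrap-around test.\<close>
        moreover have "e \<noteq> x" using xc ec by blast
        ultimately have "t' = TestUp x e" using t' Some by simp
        then show ?thesis using ue by (auto simp: serves_def)
      qed
    qed (use ReadLeft t' null in \<open>auto split: option.splits if_splits\<close>)
    then show ?thesis by blast
  next
    case (ReadUp x c)
    then obtain p where p: "up m0 c = Some p" using ok by auto
    then have t': "t' = ReadRight p" "m' = m" using ReadUp assms(3) upm by auto
    \<comment> \<open>By \<open>parent_unique\<close>, the pointer just read is the parent of every
      node that this search served.\<close>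
    have "covered A (T(v := t')) m'"
      by (rule covered_handover[OF assms(2)])
        (use ReadUp t' p null in \<open>auto simp: serves_def dest: parent_unique\<close>)
    then show ?thesis by blast
  qed (use assms(4) in auto)
qed

lemma invariant_step: "conc_step c c' \<Longrightarrow> invariant c \<Longrightarrow> invariant c'"
  by (induction rule: conc_step.induct) (auto simp: invariant_def intro: safe_step covered_step)

lemma invariant_steps: "conc_step\<^sup>*\<^sup>* c c' \<Longrightarrow> invariant c \<Longrightarrow> invariant c'"
  by (induction rule: rtranclp_induct) (auto intro: invariant_step)

text \<open>When all calls have returned, nothing is pending or served, so \<open>A\<close> is
  closed under the rules that generate \<open>Cut\<close>.\<close>

lemma finished_memory:
  assumes "invariant (T, m)" "\<And>t. T t = Returned"
  shows "m = cut_memory"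
proof -
  obtain A where s: "safe T m" and A: "covered A T m" using assms by (auto simp: invariant_def)
  have "u \<in> A" if "u \<in> Cut" for u
    using that by induction (use A in \<open>simp add: covered_def assms(2) serves_def; blast\<close>)+
  then have r: "right m u = None" if "u \<in> Cut" for u
    using A that by (auto simp: covered_def)
  have "right m u = (if u \<in> Cut then None else right m0 u)" for u
    using r s by (auto simp: safe_def)
  moreover have "left m w = (if \<exists>u\<in>Cut. right m0 u = Some w then None else left m0 w)" for w
    using r s unfolding safe_def by (simp add: assms(2)) blast
  ultimately show ?thesis using s
    by (auto simp: cut_memory_def safe_def intro!: mem.equality)
qed

section \<open>Termination\<close>

definition ahead :: "'n \<Rightarrow> 'n \<Rightarrow> nat" where
  "ahead v c = card {d. (search_hop v)\<^sup>+\<^sup>+ c d}"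

definition above :: "'n \<Rightarrow> nat" where
  "above v = card {u \<in> N. lev v < lev u}"

text \<open>A lexicographic measure written in base \<open>2 * card N + 6\<close>, one more than the
  largest remainder (that of \<open>ReadRight\<close>). Since \<open>ahead\<close> is at most
  \<open>card N\<close>, the remainder of \<open>TestUp\<close> stays below that of
  \<open>ClearLeft\<close>; the factor 2 pays for the two instructions of a loop round.\<close>

fun work :: "'n call \<Rightarrow> nat" where
  "work (ReadRight v) = above v * (2 * card N + 6) + 2 * card N + 5"
| "work (CasRight v g) = above v * (2 * card N + 6) + 2 * card N + 4"
| "work (ClearLeft v g) = above v * (2 * card N + 6) + 2 * card N + 3"
| "work (TestUp v c) = above v * (2 * card N + 6) + 2 * ahead v c + 2"
| "work (ReadLeft v c) = above v * (2 * card N + 6) + 2 * ahead v c + 1"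
| "work (ReadUp v c) = above v * (2 * card N + 6) + 1"
| "work Returned = 0"

text \<open>Here the walk may never meet an upper copy, so cycles are pushed backwards instead: left
  pointers are injective on \<open>N\<close>, hence a cycle through \<open>z\<close> contains its
  predecessor \<open>y\<close>, and in the end the start \<open>v\<close>, which
  \<open>search_hop\<close> never enters.\<close>

lemma search_acyclic:
  assumes "(search_hop v)\<^sup>*\<^sup>* v c" "v \<in> N"
  shows "\<not> (search_hop v)\<^sup>+\<^sup>+ c c"
  using assms
proof (induction rule: rtranclp_induct)
  case base
  then show ?case by (auto simp: search_hop_def elim: tranclp.cases)
next
  case (step y z)
  show ?case
  proof
    assume "(search_hop v)\<^sup>+\<^sup>+ z z"
    then obtain x where x: "(search_hop v)\<^sup>*\<^sup>* z x" "search_hop v x z" 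
      by (metis rtranclp.rtrancl_refl tranclp.cases tranclp_into_rtranclp)
    have yN: "y \<in> N" using step hops_N search_hops_hops by blast
    then have zN: "z \<in> N" using step.hyps(2) left_N by (auto simp: search_hop_def hop_def)
    then have "x \<in> N" using x(1) hops_N search_hops_hops by blast
    then have "x = y" using x(2) step.hyps(2) left_N[of x z] left_N[of y z] yN
      by (auto simp: search_hop_def hop_def)
    then have "(search_hop v)\<^sup>+\<^sup>+ y y" using x step.hyps(2) by (meson rtranclp_into_tranclp2)
    then show False using step by blast
  qed
qed

lemma search_ahead_N:
  assumes "(search_hop v)\<^sup>*\<^sup>* v c" "v \<in> N"
  shows "{d. (search_hop v)\<^sup>+\<^sup>+ c d} \<subseteq> N"
  using assms hops_N search_hops_hops by (blast dest: tranclp_into_rtranclp)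

lemma ahead_le:
  assumes "(search_hop v)\<^sup>*\<^sup>* v c" "v \<in> N"
  shows "ahead v c \<le> card N"
  unfolding ahead_def using search_ahead_N[OF assms] finite_N by (simp add: card_mono)

lemma ahead_less:
  assumes "(search_hop v)\<^sup>*\<^sup>* v c" "v \<in> N" "search_hop v c d"
  shows "ahead v d < ahead v c"
  unfolding ahead_def
proof (rule psubset_card_mono)
  show "finite {d. (search_hop v)\<^sup>+\<^sup>+ c d}"
    using search_ahead_N[OF assms(1,2)] finite_N finite_subset by blast
  have "\<not> (search_hop v)\<^sup>+\<^sup>+ d d"
    using search_acyclic assms by (meson rtranclp.rtrancl_into_rtrancl)
  then show "{e. (search_hop v)\<^sup>+\<^sup>+ d e} \<subset> {e. (search_hop v)\<^sup>+\<^sup>+ c e}"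
    using assms(3) by (auto intro: tranclp_into_tranclp2)
qed

lemma above_less:
  assumes "p \<in> N" "lev v < lev p"
  shows "above p < above v"
  unfolding above_def using assms finite_N by (intro psubset_card_mono) auto

lemma work_step:
  assumes "safe T m" "T v \<noteq> Returned" "exec (T v) m = (t', m')"
  shows "work t' < work (T v)"
proof -
  have ok: "ok_call (T v)" and upm: "up m = up m0"
    and l: "\<And>w. left m w = left m0 w \<or> left m w = None"
    using assms(1) by (auto simp: safe_def)
  show ?thesis
  proof (cases "T v")
    case (ReadUp u c)
    then obtain p where p: "up m0 c = Some p" and u: "u \<in> Cut" "hop\<^sup>*\<^sup>* u c"
      using ok search_hops_hops by auto
    then have "p \<in> N" "lev u < lev p" using Cut_N hops_N up_N by metis+
    \<comment> \<open>The level given up by climbing pays for the whole remainder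
      \<open>2 * card N + 5\<close> of the new \<open>ReadRight p\<close>.\<close>
    then have "Suc (above p) \<le> above u" using above_less by (simp add: Suc_leI)
    then have "Suc (above p) * (2 * card N + 6) \<le> above u * (2 * card N + 6)" by (rule mult_le_mono1)
    then show ?thesis using assms(3) ReadUp p upm by auto
  next
    case (ReadLeft u c)
    then have *: "(search_hop u)\<^sup>*\<^sup>* u c" "u \<in> N" "up m0 c = None" using ok Cut_N by auto
    show ?thesis
    proof (cases "t' = Returned")
      case False
      then obtain d where "t' = TestUp u d" "left m c = Some d" "d \<noteq> u"
        using assms(3) ReadLeft by (auto split: option.splits if_splits)
      moreover have "search_hop u c d" using calculation l[of c] * by (auto simp: search_hop_def hop_def)
      ultimately show ?thesis using ahead_less[OF *(1,2)] ReadLeft by fastforce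
    qed (use ReadLeft in auto)
  qed (use assms(2,3) ok upm ahead_le Cut_N in \<open>fastforce split: option.splits if_splits\<close>)+
qed

definition total_work :: "'n config \<Rightarrow> nat" where
  "total_work = (\<lambda>(T, m). \<Sum>v\<in>V. work (T v))"

lemma total_work_step:
  assumes "conc_step c c'" "invariant c"
  shows "total_work c' < total_work c"
  using assms
proof cases
  case (1 T v m t' m')
  then have s: "safe T m" using assms by (auto simp: invariant_def)
  then have "v \<in> V" using 1 by (auto simp: safe_def)
  moreover have "finite V" using V_N finite_N finite_subset by blast
  moreover have "work t' < work (T v)" using work_step s 1 by blast
  ultimately show ?thesis unfolding 1 total_work_def
    by (auto intro!: sum_strict_mono_ex1)
qed

lemma no_infinite_run:
  assumes "c 0 = initial V m0" "\<And>n. conc_step (c n) (c (Suc n))"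
  shows False
proof -
  have inv: "invariant (c n)" for n
    by (induction n) (use assms(1) invariant_initial invariant_step[OF assms(2)] in \<open>simp_all\<close>)
  have "total_work (c n) + n \<le> total_work (c 0)" for n
  proof (induction n)
    case (Suc n)
    then show ?case using total_work_step[OF assms(2) inv, of n] by simp
  qed simp
  from this[of "Suc (total_work (c 0))"] show False by simp
qed

section \<open>Sequential runs are concurrent runs\<close>

text \<open>Running one call alone is one particular schedule, so \<open>total_work\<close> bounds
  it. Any invariant configuration is allowed, because later calls start from the memory left by
  earlier ones.\<close>

lemma solo_run_exists:
  "invariant (T, m) \<Longrightarrow> \<exists>m'. solo_step\<^sup>*\<^sup>* (T v, m) (Returned, m')"
proof (induction "total_work (T, m)" arbitrary: T m rule: less_induct)
  case less
  show ?case
  proof (cases "T v = Returned")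
    case False
    obtain t' m1 where e: "exec (T v) m = (t', m1)" by force
    then have c: "conc_step (T, m) (T(v := t'), m1)" using False by (rule conc_step.intros[rotated])
    from less.hyps[OF total_work_step[OF c less.prems] invariant_step[OF c less.prems]]
    obtain m' where "solo_step\<^sup>*\<^sup>* (t', m1) (Returned, m')" by auto
    moreover have "solo_step (T v, m) (t', m1)" using solo_step.intros[OF False] e by metis
    ultimately show ?thesis by (meson converse_rtranclp_into_rtranclp)
  qed auto
qed

lemma solo_conc:
  "solo_step\<^sup>*\<^sup>* (t, m) (t', m') \<Longrightarrow> conc_step\<^sup>*\<^sup>* (T(v := t), m) (T(v := t'), m')"
proof (induction "(t', m')" arbitrary: t' m' rule: rtranclp_induct)
  case (step y)
  obtain s k where y: "y = (s, k)" by force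
  from step(2) y have "s \<noteq> Returned" "exec s k = (t', m')" by (auto elim: solo_step.cases)
  then have "conc_step (T(v := s), k) ((T(v := s))(v := t'), m')"
    by (intro conc_step.intros) auto
  then show ?case using step(3)[OF y] by simp
qed simp

text \<open>A call whose turn has not come rests at its entry point \<open>ReadRight\<close>, so
  running the calls one by one is a schedule of the concurrent system.\<close>

lemma sequential_result_conc:
  assumes "sequential_result vs m m'" "distinct vs" "\<And>v. v \<in> set vs \<Longrightarrow> T v = ReadRight v"
  shows "conc_step\<^sup>*\<^sup>* (T, m) (\<lambda>v. if v \<in> set vs then Returned else T v, m')"
  using assms
proof (induction vs arbitrary: m T)
  case (Cons v vs)
  then obtain m1 where m1: "split_result v m m1" "sequential_result vs m1 m'" by auto
  have "T(v := ReadRight v) = T" using Cons.prems by auto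
  then have "conc_step\<^sup>*\<^sup>* (T, m) (T(v := Returned), m1)"
    using solo_conc[of "ReadRight v" m Returned m1 T v] m1 by (simp add: split_result_def)
  moreover have "conc_step\<^sup>*\<^sup>* (T(v := Returned), m1)
      (\<lambda>u. if u \<in> set vs then Returned else (T(v := Returned)) u, m')"
    using m1 Cons.prems by (intro Cons.IH) auto
  moreover have "(\<lambda>u. if u \<in> set vs then Returned else (T(v := Returned)) u)
      = (\<lambda>u. if u \<in> set (v # vs) then Returned else T u)" by auto
  ultimately show ?case by (metis (no_types, lifting) rtranclp_trans)
qed simp

lemma sequential_result_exists:
  assumes "invariant (T, m)" "distinct vs" "\<And>v. v \<in> set vs \<Longrightarrow> T v = ReadRight v"
  shows "\<exists>m'. sequential_result vs m m'"
  using assms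
proof (induction vs arbitrary: m T)
  case (Cons v vs)
  then obtain m1 where m1: "solo_step\<^sup>*\<^sup>* (ReadRight v, m) (Returned, m1)"
    using solo_run_exists[of T m v] by auto
  have "T(v := ReadRight v) = T" using Cons.prems by auto
  then have "invariant (T(v := Returned), m1)"
    using solo_conc[OF m1, of T v] invariant_steps Cons.prems(1) by metis
  moreover have "distinct vs" "\<And>u. u \<in> set vs \<Longrightarrow> (T(v := Returned)) u = ReadRight u"
    using Cons.prems by auto
  ultimately have "\<exists>m'. sequential_result vs m1 m'" by (rule Cons.IH)
  then show ?case using m1 by (auto simp: split_result_def)
qed (metis sequential_result.simps(1))

lemma sequential_result_iff:
  assumes "distinct vs" "set vs = V"
  shows "sequential_result vs m0 m' \<longleftrightarrow> m' = cut_memory"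
proof -
  let ?T = "\<lambda>v. if v \<in> V then ReadRight v else Returned"
  have i: "invariant (?T, m0)" using invariant_initial by (simp add: initial_def)
  have *: "m' = cut_memory" if "sequential_result vs m0 m'" for m'
    by (rule finished_memory[OF invariant_steps[OF sequential_result_conc[OF that assms(1)] i]])
      (auto simp: assms)
  moreover have "\<exists>m'. sequential_result vs m0 m'"
    using sequential_result_exists[OF i assms(1)] by (simp add: assms)
  ultimately show ?thesis by blast
qed

lemma stuck_all_returned:
  assumes "\<not> (\<exists>c. conc_step (T, m) c)"
  shows "T v = Returned"
  using assms conc_step.intros[of T v m] by (metis surj_pair)

end

section \<open>Lists of nodes at one level\<close>

text \<open>An index-free form: decompositions of lists, unlike positions, carry over between a list
  of elements and its \<open>level_nodes\<close>.\<close>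

lemma linked_linear_iff:
  "linked_linear m ns \<longleftrightarrow>
     (\<forall>P u w Q. ns = P @ u # w # Q \<longrightarrow> right m u = Some w \<and> left m w = Some u) \<and>
     (ns \<noteq> [] \<longrightarrow> right m (last ns) = None \<and> left m (hd ns) = None)"
  (is "_ \<longleftrightarrow> ?adj \<and> ?ends")
proof
  assume l: "linked_linear m ns"
  have ?adj
  proof (intro allI impI)
    fix P u w Q assume "ns = P @ u # w # Q"
    then show "right m u = Some w \<and> left m w = Some u"
      using l[unfolded linked_linear_def, rule_format, of "length P"]
        l[unfolded linked_linear_def, rule_format, of "Suc (length P)"]
      by (simp add: nth_append)
  qed
  moreover have ?ends
    using l[unfolded linked_linear_def, rule_format, of 0]
      l[unfolded linked_linear_def, rule_format, of "length ns - 1"]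
    by (auto simp: hd_conv_nth last_conv_nth)
  ultimately show "?adj \<and> ?ends" by blast
next
  assume r: "?adj \<and> ?ends"
  have adj: "right m (ns ! k) = Some (ns ! Suc k) \<and> left m (ns ! Suc k) = Some (ns ! k)"
    if "Suc k < length ns" for k
  proof -
    have "ns = take k ns @ ns ! k # ns ! Suc k # drop (Suc (Suc k)) ns"
      using that by (metis Cons_nth_drop_Suc Suc_lessD append_take_drop_id)
    then show ?thesis using r by blast
  qed
  show "linked_linear m ns"
    unfolding linked_linear_def
  proof (intro allI impI conjI)
    fix k assume k: "k < length ns"
    show "right m (ns ! k) = (if Suc k < length ns then Some (ns ! Suc k) else None)"
    proof (cases "Suc k < length ns")
      case False
      then have "k = length ns - 1" using k by simp
      then have "ns ! k = last ns" using k by (metis last_conv_nth length_0_conv not_less_zero)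
      then show ?thesis using r False k by auto
    qed (use adj in simp)
    show "left m (ns ! k) = (if 0 < k then Some (ns ! (k - 1)) else None)"
    proof (cases k)
      case 0
      then show ?thesis using r k by (auto simp: hd_conv_nth)
    qed (use adj k in simp)
  qed
qed

lemma linked_cyclicD:
  assumes "linked_cyclic m ns"
  shows "ns = P @ u # w # Q \<Longrightarrow> right m u = Some w \<and> left m w = Some u"
    and "ns \<noteq> [] \<Longrightarrow> right m (last ns) = Some (hd ns) \<and> left m (hd ns) = Some (last ns)"
proof -
  note l = assms[unfolded linked_cyclic_def, rule_format]
  show "right m u = Some w \<and> left m w = Some u" if "ns = P @ u # w # Q"
    using l[of "length P"] that by (simp add: nth_append)
  show "right m (last ns) = Some (hd ns) \<and> left m (hd ns) = Some (last ns)" if "ns \<noteq> []"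
    using l[of "length ns - 1"] that by (simp add: hd_conv_nth last_conv_nth)
qed

lemma linked_cyclic_rotate:
  assumes "linked_cyclic m ns"
  shows "linked_cyclic m (rotate n ns)"
  unfolding linked_cyclic_def
proof (intro allI impI)
  fix k assume "k < length (rotate n ns)"
  then have k: "k < length ns" by simp
  then have pos: "0 < length ns" by linarith
  have "right m (ns ! ((n + k) mod length ns)) = Some (ns ! (Suc ((n + k) mod length ns) mod length ns)) \<and>
     left m (ns ! (Suc ((n + k) mod length ns) mod length ns)) = Some (ns ! ((n + k) mod length ns))"
    using assms pos unfolding linked_cyclic_def by simp
  moreover have "Suc ((n + k) mod length ns) mod length ns = (n + Suc k mod length ns) mod length ns"
    by (simp add: mod_simps)
  ultimately show "right m (rotate n ns ! k) = Some (rotate n ns ! (Suc k mod length (rotate n ns))) \<and>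
     left m (rotate n ns ! (Suc k mod length (rotate n ns))) = Some (rotate n ns ! k)"
    using k pos by (simp add: nth_rotate)
qed

lemma level_nodes_append [simp]: "level_nodes h i (xs @ ys) = level_nodes h i xs @ level_nodes h i ys"
  by (simp add: level_nodes_def)

lemma level_nodes_Cons [simp]:
  "level_nodes h i (x # xs) = (if i \<le> h x then (x, i) # level_nodes h i xs else level_nodes h i xs)"
  by (simp add: level_nodes_def)

lemma level_nodes_eq_Nil: "level_nodes h i xs = [] \<longleftrightarrow> (\<forall>x\<in>set xs. h x < i)"
  by (auto simp: level_nodes_def filter_empty_conv not_le)

text \<open>As a simplification rule this deletes a stretch of elements lower than \<open>i\<close>,
  so that the nodes around it become adjacent.\<close>

lemmas level_nodes_empty [simp] = level_nodes_eq_Nil[THEN iffD2]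

lemma set_level_nodes: "(x, j) \<in> set (level_nodes h i xs) \<longleftrightarrow> x \<in> set xs \<and> j = i \<and> i \<le> h x"
  by (auto simp: level_nodes_def)

text \<open>The amount of rotation changes: only moved elements of height at least \<open>i\<close>
  count.\<close>

lemma level_nodes_rotate: "\<exists>k. level_nodes h i (rotate n xs) = rotate k (level_nodes h i xs)"
proof -
  let ?j = "n mod length xs"
  have "rotate n xs = drop ?j xs @ take ?j xs" by (rule rotate_drop_take)
  then have "level_nodes h i (rotate n xs)
      = rotate (length (level_nodes h i (take ?j xs))) (level_nodes h i (take ?j xs) @ level_nodes h i (drop ?j xs))"
    by (simp add: rotate_append)
  then show ?thesis by (metis append_take_drop_id level_nodes_append)
qed

lemma level_nodes_eq_append:
  assumes "level_nodes h i xs = P @ Q"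
  shows "\<exists>ys zs. xs = ys @ zs \<and> P = level_nodes h i ys \<and> Q = level_nodes h i zs"
  using assms
proof (induction xs arbitrary: P)
  case Nil
  then show ?case by (auto simp: level_nodes_def)
next
  case (Cons x xs)
  show ?case
  proof (cases "P = []")
    case True
    then show ?thesis using Cons.prems by (intro exI[of _ "[]"] exI[of _ "x # xs"]) (simp add: level_nodes_def)
  next
    case False
    show ?thesis
    proof (cases "i \<le> h x")
      case True
      then obtain P' where P': "P = (x, i) # P'" "level_nodes h i xs = P' @ Q"
        using Cons.prems False by (cases P) auto
      from Cons.IH[OF this(2)] obtain ys zs where
        "xs = ys @ zs" "P' = level_nodes h i ys" "Q = level_nodes h i zs" by blast
      then show ?thesis using P' True by (intro exI[of _ "x # ys"] exI[of _ zs]) simp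
    next
      case F: False
      then have "level_nodes h i xs = P @ Q" using Cons.prems by simp
      from Cons.IH[OF this] obtain ys zs where
        "xs = ys @ zs" "P = level_nodes h i ys" "Q = level_nodes h i zs" by blast
      then show ?thesis using F by (intro exI[of _ "x # ys"] exI[of _ zs]) simp
    qed
  qed
qed

lemma level_nodes_eq_Cons:
  assumes "level_nodes h i xs = u # Q"
  shows "\<exists>q x zs. xs = q @ x # zs \<and> (\<forall>y\<in>set q. h y < i) \<and> i \<le> h x \<and> u = (x, i) \<and> Q = level_nodes h i zs"
  using assms
proof (induction xs)
  case (Cons x xs)
  show ?case
  proof (cases "i \<le> h x")
    case True
    then show ?thesis using Cons.prems by (intro exI[of _ "[]"]) auto
  next
    case False
    then obtain q y zs where "xs = q @ y # zs" "\<forall>y\<in>set q. h y < i" "i \<le> h y" "u = (y, i)"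
      "Q = level_nodes h i zs" using Cons by auto
    then show ?thesis using False by (intro exI[of _ "x # q"] exI[of _ y] exI[of _ zs]) auto
  qed
qed (simp add: level_nodes_def)

lemma level_nodes_adjacent:
  assumes "level_nodes h i xs = P @ u # w # Q"
  shows "\<exists>p x q y r. xs = p @ x # q @ y # r \<and> (\<forall>z\<in>set q. h z < i) \<and> i \<le> h x \<and> i \<le> h y \<and>
    u = (x, i) \<and> w = (y, i)"
proof -
  obtain ys zs where a: "xs = ys @ zs" "u # w # Q = level_nodes h i zs"
    using level_nodes_eq_append[OF assms] by blast
  obtain q x zs' where b: "zs = q @ x # zs'" "i \<le> h x" "u = (x, i)" "w # Q = level_nodes h i zs'"
    using level_nodes_eq_Cons[OF a(2)[symmetric]] by blast
  obtain q' y r where c: "zs' = q' @ y # r" "\<forall>z\<in>set q'. h z < i" "i \<le> h y" "w = (y, i)"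
    using level_nodes_eq_Cons[OF b(4)[symmetric]] by blast
  show ?thesis
    using a b c by (intro exI[of _ "ys @ q"] exI[of _ x] exI[of _ q'] exI[of _ y] exI[of _ r]) auto
qed

lemma level_nodes_last:
  assumes "level_nodes h i xs = P @ [u]"
  shows "\<exists>p x q. xs = p @ x # q \<and> (\<forall>z\<in>set q. h z < i) \<and> i \<le> h x \<and> u = (x, i)"
proof -
  obtain ys zs where a: "xs = ys @ zs" "[u] = level_nodes h i zs"
    using level_nodes_eq_append[OF assms] by blast
  obtain q x zs' where b: "zs = q @ x # zs'" "i \<le> h x" "u = (x, i)" "[] = level_nodes h i zs'"
    using level_nodes_eq_Cons[OF a(2)[symmetric]] by blast
  have "\<forall>z\<in>set zs'. h z < i" using b(4) level_nodes_eq_Nil by metis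
  then show ?thesis
    using a b by (intro exI[of _ "ys @ q"] exI[of _ x] exI[of _ zs']) auto
qed

lemma linked_neighbours:
  assumes "linked_linear m ns \<or> linked_cyclic m ns" "u \<in> set ns"
  shows "right m u = Some w \<Longrightarrow> w \<in> set ns \<and> left m w = Some u"
    and "left m u = Some w \<Longrightarrow> w \<in> set ns \<and> right m w = Some u"
proof -
  obtain P Q where ns: "ns = P @ u # Q" using assms(2) by (meson split_list)
  have adj: "ns = P @ u # w # Q \<Longrightarrow> right m u = Some w \<and> left m w = Some u" for P u w Q
    using assms(1) linked_linear_iff linked_cyclicD(1) by metis
  have ends: "right m (last ns) = None \<and> left m (hd ns) = None \<or>
      right m (last ns) = Some (hd ns) \<and> left m (hd ns) = Some (last ns)"
    using assms linked_linear_iff[of m ns] linked_cyclicD(2)[of m ns] by fastforce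
  show "w \<in> set ns \<and> left m w = Some u" if "right m u = Some w"
  proof (cases Q)
    case Nil
    then have "last ns = u" using ns by simp
    then show ?thesis using ends that ns by (metis append_is_Nil_conv hd_in_set list.distinct(1) option.distinct(1) option.inject)
  next
    case (Cons v Q')
    then show ?thesis using adj[of P u v Q'] ns that by auto
  qed
  show "w \<in> set ns \<and> right m w = Some u" if "left m u = Some w"
  proof (cases P rule: rev_cases)
    case Nil
    then have "hd ns = u" using ns by simp
    then show ?thesis using ends that ns by (metis append_is_Nil_conv last_in_set list.distinct(1) option.distinct(1) option.inject)
  next
    case (snoc P' v)
    then show ?thesis using adj[of P' v u Q] ns that by auto
  qed
qed

section \<open>Blocks of a broken sequence\<close>

lemma concat_chop [simp]: "concat (chop B xs) = xs"
  by (induction xs) (auto split: list.split)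

lemma chop_block:
  assumes "blk \<in> set (chop B xs)"
  shows "\<exists>ys zs. xs = ys @ blk @ zs \<and> (ys = [] \<or> last ys \<in> B) \<and>
    (zs = [] \<or> last blk \<in> B) \<and> set (butlast blk) \<inter> B = {}"
  using assms
proof (induction "length xs" arbitrary: xs rule: less_induct)
  case less
  show ?case
  proof (cases "set xs \<inter> B = {}")
    case True
    then have "blk = xs" using less.prems by (auto simp: chop_disjoint split: if_splits)
    then show ?thesis using True by (intro exI[of _ "[]"]) (auto dest: in_set_butlastD)
  next
    case False
    then obtain as x bs where xs: "xs = as @ x # bs" "x \<in> B" "set as \<inter> B = {}"
      using split_list_first_prop[of xs "\<lambda>x. x \<in> B"] by blast
    then consider "blk = as @ [x]" | "blk \<in> set (chop B bs)"
      using less.prems by (auto simp: chop_append)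
    then show ?thesis
    proof cases
      case 1
      then show ?thesis using xs by (intro exI[of _ "[]"] exI[of _ bs]) auto
    next
      case 2
      obtain ys zs where "bs = ys @ blk @ zs" "ys = [] \<or> last ys \<in> B"
        "zs = [] \<or> last blk \<in> B" "set (butlast blk) \<inter> B = {}"
        using less.hyps[OF _ 2] xs by auto
      then show ?thesis using xs by (intro exI[of _ "as @ x # ys"] exI[of _ zs]) auto
    qed
  qed
qed

lemma distinct_append_Cons_eq:
  assumes "distinct (p @ x # q)" "p @ x # q = p' @ x # q'"
  shows "p = p' \<and> q = q'"
  using assms by (metis append_Cons_eq_iff distinct_append distinct.simps(2) not_distinct_conv_prefix disjoint_iff list.set_intros(1))

text \<open>The list that \<open>break_seq\<close> chops whenever it chops one; it allows linear and
  cyclic sequences to be treated together.\<close>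

fun opened :: "'a set \<Rightarrow> 'a seq \<Rightarrow> 'a list" where
  "opened B (Linear xs) = xs"
| "opened B (Cyclic xs) =
     (if set xs \<inter> B = {} then xs else rotate (Suc (length (takeWhile (\<lambda>x. x \<notin> B) xs))) xs)"

fun is_cyclic :: "'a seq \<Rightarrow> bool" where
  "is_cyclic (Linear xs) = False"
| "is_cyclic (Cyclic xs) = True"

lemma set_opened [simp]: "set (opened B s) = set (seq_list s)"
  by (cases s) auto

lemma distinct_opened [simp]: "distinct (opened B s) = distinct (seq_list s)"
  by (cases s) auto

lemma break_seq_opened:
  "break_seq B s = (if is_cyclic s \<and> set (seq_list s) \<inter> B = {} then {s} else Linear ` set (chop B (opened B s)))"
  by (cases s) auto

lemma break_seq_subset: "s' \<in> break_seq B s \<Longrightarrow> set (seq_list s') \<subseteq> set (seq_list s)"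
proof -
  have "set blk \<subseteq> set (seq_list s)" if "blk \<in> set (chop B (opened B s))" for blk
    using that concat_chop[of B "opened B s"] set_concat[of "chop B (opened B s)"] set_opened[of B s] by auto
  then show "s' \<in> break_seq B s \<Longrightarrow> set (seq_list s') \<subseteq> set (seq_list s)"
    by (fastforce simp: break_seq_opened split: if_splits)
qed

lemma break_seq_distinct:
  assumes "distinct (seq_list s)" "s1 \<in> break_seq B s"
  shows "distinct (seq_list s1)"
    and "\<lbrakk>s2 \<in> break_seq B s; s1 \<noteq> s2\<rbrakk> \<Longrightarrow> set (seq_list s1) \<inter> set (seq_list s2) = {}"
proof -
  have "distinct (concat (chop B (opened B s)))" using assms(1) by simp
  note * = this[unfolded distinct_concat_iff]
  show "distinct (seq_list s1)" using assms * by (auto simp: break_seq_opened split: if_splits)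
  show "set (seq_list s1) \<inter> set (seq_list s2) = {}" if "s2 \<in> break_seq B s" "s1 \<noteq> s2"
  proof (cases "is_cyclic s \<and> set (seq_list s) \<inter> B = {}")
    case True
    then show ?thesis using that assms(2) by (simp add: break_seq_opened)
  next
    case False
    then have "s1 \<in> Linear ` set (chop B (opened B s))" "s2 \<in> Linear ` set (chop B (opened B s))"
      using that(1) assms(2) unfolding break_seq_opened by (simp_all split: if_splits)
    then show ?thesis using * that(2) by (elim imageE) (metis seq.sel(1))
  qed
qed

lemma last_opened_Cyclic:
  assumes "set xs \<inter> B \<noteq> {}"
  shows "last (opened B (Cyclic xs)) \<in> B"
proof -
  obtain as x bs where xs: "xs = as @ x # bs" "x \<in> B" "set as \<inter> B = {}"
    using assms split_list_first_prop[of xs "\<lambda>x. x \<in> B"] by blast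
  then have "takeWhile (\<lambda>x. x \<notin> B) xs = as"
    by (simp add: takeWhile_append) blast
  moreover have "rotate (Suc (length as)) xs = (bs @ as) @ [x]"
    using rotate_append[of "as @ [x]" bs] xs by simp
  ultimately show ?thesis using assms xs(2) by simp
qed

section \<open>The cut nodes of a skip list\<close>

locale skip_list_split =
  fixes h :: "'a \<Rightarrow> nat" and L :: "'a seq set" and m :: "'a node mem" and B :: "'a set"
  assumes valid: "valid_skip_list h L m"
    and B_L: "B \<subseteq> elements L"
begin

definition nodes :: "'a node set" where
  "nodes = (SIGMA x:elements L. {1..h x})"

definition starts :: "'a node set" where
  "starts = (\<lambda>x. (x, 1)) ` B"

lemma nodes_iff: "u \<in> nodes \<longleftrightarrow> fst u \<in> elements L \<and> 1 \<le> snd u \<and> snd u \<le> h (fst u)"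
  by (cases u) (auto simp: nodes_def)

lemma height_pos: "x \<in> elements L \<Longrightarrow> 1 \<le> h x"
  using valid by (auto simp: valid_skip_list_def)

lemma up_eq: "\<lbrakk>x \<in> elements L; 1 \<le> i; i \<le> h x\<rbrakk> \<Longrightarrow> up m (x, i) = (if i < h x then Some (x, i + 1) else None)"
  using valid by (auto simp: valid_skip_list_def)

lemma node_level_list:
  assumes "(x, i) \<in> nodes"
  shows "\<exists>xs. set xs \<subseteq> elements L \<and> (x, i) \<in> set (level_nodes h i xs) \<and>
    (linked_linear m (level_nodes h i xs) \<or> linked_cyclic m (level_nodes h i xs))"
proof -
  obtain s where s: "s \<in> L" "x \<in> set (seq_list s)" using assms by (auto simp: elements_def nodes_iff)
  then have "linked_at_level h m i s" using valid assms by (auto simp: valid_skip_list_def nodes_iff)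
  then show ?thesis using s assms
    by (intro exI[of _ "seq_list s"], cases s) (auto simp: elements_def set_level_nodes nodes_iff)
qed

sublocale split_memory m nodes starts snd
proof
  have "finite (elements L)" using valid by (auto simp: elements_def valid_skip_list_def)
  then show "finite nodes" by (simp add: nodes_def)
  show "starts \<subseteq> nodes" using B_L height_pos by (auto simp: nodes_iff starts_def)
  fix u w
  assume u: "u \<in> nodes"
  obtain x i where ui: "u = (x, i)" by force
  obtain xs where xs: "set xs \<subseteq> elements L" "u \<in> set (level_nodes h i xs)"
    "linked_linear m (level_nodes h i xs) \<or> linked_cyclic m (level_nodes h i xs)"
    using node_level_list u ui by blast
  have lvl: "w \<in> nodes \<and> snd w = i" if "w \<in> set (level_nodes h i xs)"
    using that xs(1) u ui by (auto simp: level_nodes_def nodes_iff)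
  show "w \<in> nodes \<and> left m w = Some u" if "right m u = Some w"
    using linked_neighbours(1)[OF xs(3,2) that] lvl by blast
  show "w \<in> nodes \<and> right m w = Some u \<and> snd w = snd u" if "left m u = Some w"
    using linked_neighbours(2)[OF xs(3,2) that] lvl ui by simp
  show "w \<in> nodes \<and> snd u < snd w" if "up m u = Some w"
    using that u ui up_eq by (auto simp: nodes_iff split: if_splits)
qed

text \<open>A cyclic list that meets \<open>B\<close> is opened after an element of \<open>B\<close>. A search that wraps around
  such a list therefore climbs to a node that a search from the last element reaches without
  wrapping, so \<open>cut_at\<close>, which looks at \<open>xs\<close> as a linear list, describes the cuts in both cases.\<close>

definition strand :: "bool \<Rightarrow> 'a list \<Rightarrow> bool" where
  "strand cyc xs \<longleftrightarrow> distinct xs \<and> set xs \<subseteq> elements L \<and>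
     (\<forall>i\<ge>1. if cyc then linked_cyclic m (level_nodes h i xs) else linked_linear m (level_nodes h i xs)) \<and>
     (cyc \<longrightarrow> set xs \<inter> B = {} \<or> last xs \<in> B)"

definition cut_at :: "'a list \<Rightarrow> nat \<Rightarrow> 'a \<Rightarrow> bool" where
  "cut_at xs i x \<longleftrightarrow>
     (\<exists>p q r. xs = p @ x # q @ r \<and> (\<forall>z\<in>set q. h z < i) \<and> set (x # q) \<inter> B \<noteq> {})"

lemma strand_opened:
  assumes "s \<in> L"
  shows "strand (is_cyclic s) (opened B s)"
proof -
  have "distinct (seq_list s)" "\<forall>i\<ge>1. linked_at_level h m i s" "set (seq_list s) \<subseteq> elements L"
    using valid assms by (auto simp: valid_skip_list_def elements_def)
  moreover have "linked_cyclic m (level_nodes h i (rotate n xs))"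
    if "linked_cyclic m (level_nodes h i xs)" for i n xs
    using level_nodes_rotate[of h i n xs] linked_cyclic_rotate[OF that] by auto
  ultimately show ?thesis
    using last_opened_Cyclic[of _ B] unfolding strand_def by (cases s) (auto simp del: rotate_Suc)
qed

section \<open>Links and walks within one strand\<close>

lemma strand_links:
  assumes "strand cyc xs" "1 \<le> i"
  shows "linked_linear m (level_nodes h i xs) \<or> linked_cyclic m (level_nodes h i xs)"
  using assms unfolding strand_def by (meson)

lemma strand_adjacent:
  assumes "strand cyc xs" "1 \<le> i" "xs = p @ d # q @ c # r" "\<forall>z\<in>set q. h z < i" "i \<le> h d" "i \<le> h c"
  shows "right m (d, i) = Some (c, i) \<and> left m (c, i) = Some (d, i)"
proof -
  have "level_nodes h i xs = level_nodes h i p @ (d, i) # (c, i) # level_nodes h i r"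
    using assms by simp
  then show ?thesis using strand_links[OF assms(1,2)] linked_linear_iff linked_cyclicD(1) by metis
qed

lemma strand_left:
  assumes "strand cyc xs" "c \<in> set xs" "1 \<le> i" "i \<le> h c" "left m (c, i) = Some e"
  shows "\<exists>d. e = (d, i) \<and> i \<le> h d \<and>
    ((\<exists>p q r. xs = p @ d # q @ c # r \<and> (\<forall>z\<in>set q. h z < i)) \<or>
     cyc \<and> (\<exists>p q. xs = p @ d # q \<and> (\<forall>z\<in>set q. h z < i)))"
proof -
  let ?ns = "level_nodes h i xs"
  have "(c, i) \<in> set ?ns" using assms by (simp add: set_level_nodes)
  then obtain P Q where ns: "?ns = P @ (c, i) # Q" by (meson split_list)
  show ?thesis
  proof (cases P rule: rev_cases)
    case Nil
    then have "hd ?ns = (c, i)" "?ns \<noteq> []" using ns by auto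
    then have "cyc" "e = last ?ns"
      using assms(1,3,5) linked_linear_iff[of m ?ns] linked_cyclicD(2)[of m ?ns]
      unfolding strand_def by (auto split: if_splits)
    moreover have "?ns = butlast ?ns @ [last ?ns]" using \<open>?ns \<noteq> []\<close> by simp
    ultimately show ?thesis using level_nodes_last by metis
  next
    case (snoc P' v)
    then have ns': "?ns = P' @ v # (c, i) # Q" using ns by simp
    then have "left m (c, i) = Some v"
      using strand_links[OF assms(1,3)] linked_linear_iff linked_cyclicD(1) by metis
    then have "e = v" using assms(5) by simp
    then show ?thesis using level_nodes_adjacent[OF ns'] by blast
  qed
qed

text \<open>Links at level \<open>i\<close> jump over the lower elements of \<open>q\<close>; those
  of height exactly \<open>i\<close> have no upper copy, so the walk continues through them.\<close>

lemma strand_hops: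
  assumes "strand cyc xs" "1 \<le> i" "i \<le> h x"
  shows "xs = p @ x # q @ y # r \<Longrightarrow> h y = i \<Longrightarrow> \<forall>z\<in>set q. h z \<le> i \<Longrightarrow> hop\<^sup>*\<^sup>* (y, i) (x, i)"
proof (induction "length q" arbitrary: q y r rule: less_induct)
  case less
  have "y \<in> elements L" using assms(1) less.prems(1) by (auto simp: strand_def)
  then have up: "up m (y, i) = None" using up_eq less.prems(2) assms(2) by simp
  show ?case
  proof (cases "\<forall>z\<in>set q. h z < i")
    case True
    then have "left m (y, i) = Some (x, i)"
      using strand_adjacent[OF assms(1,2) less.prems(1)] assms(3) less.prems(2) by simp
    then show ?thesis using up by (auto simp: hop_def)
  next
    case False
    then obtain q1 z q2 where q: "q = q1 @ z # q2" "i \<le> h z" "\<forall>z\<in>set q2. h z < i"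
      using split_list_last_prop[of q "\<lambda>z. i \<le> h z"] by (auto simp: not_less not_le)
    have "left m (y, i) = Some (z, i)"
      using strand_adjacent[OF assms(1,2), of "p @ x # q1" z q2 y r] less.prems q by simp
    then have "hop (y, i) (z, i)" using up by (simp add: hop_def)
    moreover have "hop\<^sup>*\<^sup>* (z, i) (x, i)"
      using less.hyps[of q1 z "q2 @ y # r"] less.prems q by simp
    ultimately show ?thesis by (rule converse_rtranclp_into_rtranclp)
  qed
qed

text \<open>If \<open>b\<close> in \<open>B\<close> witnesses \<open>cut_at\<close> for
  \<open>x\<close> at level \<open>Suc i\<close>, it also does so at level \<open>i\<close> for
  \<open>y\<close>, the last element of height at least \<open>i\<close> up to \<open>b\<close>. The
  walk from \<open>(y, i)\<close> then reaches \<open>(x, i)\<close> and climbs there.\<close>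

lemma cut_at_Cut:
  assumes "strand cyc xs" "1 \<le> i"
  shows "cut_at xs i x \<Longrightarrow> i \<le> h x \<Longrightarrow> (x, i) \<in> Cut"
  using assms(2)
proof (induction i arbitrary: x rule: dec_induct)
  case base
  then obtain p q r where q: "xs = p @ x # q @ r" "\<forall>z\<in>set q. h z < 1" "set (x # q) \<inter> B \<noteq> {}"
    by (auto simp: cut_at_def)
  \<comment> \<open>All heights are at least 1, so level 1 skips no element and \<open>x\<close>
    itself is in \<open>B\<close>.\<close>
  have "q = []"
  proof (rule ccontr)
    assume "q \<noteq> []"
    then obtain z where "z \<in> set q" by (meson list.set_sel(1))
    moreover from this have "z \<in> elements L" using assms(1) q(1) by (auto simp: strand_def)
    ultimately show False using q(2) height_pos by force
  qed
  then have "(x, 1) \<in> starts" using q by (auto simp: starts_def)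
  then show ?case by (rule Cut.start)
next
  case (step i)
  then obtain p q r where q: "xs = p @ x # q @ r" "\<forall>z\<in>set q. h z < Suc i" "set (x # q) \<inter> B \<noteq> {}"
    by (auto simp: cut_at_def)
  then obtain b where "b \<in> set (x # q)" "b \<in> B" by blast
  then obtain as bs where ab: "x # q = as @ b # bs" by (meson split_list)
  \<comment> \<open>The element \<open>y\<close> exists because \<open>x\<close> is itself a
    candidate.\<close>
  then have "x \<in> set (as @ [b])" by (cases as) auto
  then have "(x, i) \<in> set (level_nodes h i (as @ [b]))" using step.prems by (simp add: set_level_nodes del: level_nodes_append)
  then obtain P u where "level_nodes h i (as @ [b]) = P @ [u]" by (metis append_butlast_last_id empty_iff list.set(1))
  from level_nodes_last[OF this] obtain p1 y q1 where
    y: "as @ [b] = p1 @ y # q1" "\<forall>z\<in>set q1. h z < i" "i \<le> h y" by blast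
  have xq: "x # q = p1 @ y # q1 @ bs" using ab y(1) by (metis append.assoc append_Cons append_Nil)
  have "last (y # q1) = b" using y(1) by (metis last_appendR last_snoc list.distinct(1))
  then have "b \<in> set (y # q1)" by (metis last_in_set list.distinct(1))
  moreover have "xs = (p @ p1) @ y # q1 @ bs @ r" using q(1) xq by simp
  ultimately have "cut_at xs i y" unfolding cut_at_def using y(2) \<open>b \<in> B\<close> by blast
  then have Cut: "(y, i) \<in> Cut" using step.IH y(3) by blast
  have "hop\<^sup>*\<^sup>* (y, i) (x, i)"
  proof (cases p1)
    case Nil
    then show ?thesis using xq by simp
  next
    case (Cons x' p2)
    then have p2: "p1 = x # p2" "q = p2 @ y # q1 @ bs" using xq by auto
    then have "\<forall>z\<in>set p2. h z \<le> i" "h y = i" using q(2) y(3) by (auto simp: less_Suc_eq_le)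
    then show ?thesis
      using strand_hops[OF assms(1), of i x p p2 y "q1 @ bs @ r"] step q(1) p2 by simp
  qed
  moreover have "up m (x, i) = Some (x, Suc i)"
    using up_eq[of x i] step q(1) assms(1) by (auto simp: strand_def)
  ultimately show ?case using Cut by (rule Cut.climb[rotated])
qed

text \<open>In \<open>Cut_cut_at\<close> only the end of a walk is known to lie in the strand;
  inverse right links carry this back to its start.\<close>

lemma strand_hop_back:
  assumes "strand cyc xs" "c \<in> nodes" "hop c d" "fst d \<in> set xs"
  shows "fst c \<in> set xs"
proof -
  have d: "d \<in> nodes" "right m d = Some c" "snd d = snd c"
    using left_N[of c d] assms by (auto simp: hop_def)
  then have "d \<in> set (level_nodes h (snd d) xs)" "1 \<le> snd d"
    using assms(4) by (cases d; auto simp: set_level_nodes nodes_iff)+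
  then have "c \<in> set (level_nodes h (snd d) xs)"
    using linked_neighbours(1)[OF strand_links[OF assms(1)]] d(2) by blast
  then show ?thesis by (auto simp: level_nodes_def)
qed

text \<open>Without wrap-around, the stretch of \<open>c\<close> is appended to that of
  \<open>d\<close>, as \<open>h c < Suc i\<close>. With wrap-around, \<open>d\<close> is the last
  element of height at least \<open>i\<close>, and the last element of the strand is in
  \<open>B\<close>.\<close>

lemma cut_at_left:
  assumes "strand cyc xs" "c \<in> set xs" "1 \<le> i" "i = h c" "left m (c, i) = Some (d, i)"
    "cut_at xs (Suc i) c"
  shows "cut_at xs (Suc i) d"
proof -
  consider p q r where "xs = p @ d # q @ c # r" "\<forall>z\<in>set q. h z < i"
    | p q where cyc "xs = p @ d # q" "\<forall>z\<in>set q. h z < i"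
    using strand_left[OF assms(1,2,3) _ assms(5)] assms(4) by blast
  then show ?thesis
  proof cases
    case 1
    obtain p' q' r' where c: "xs = p' @ c # q' @ r'" "\<forall>z\<in>set q'. h z < Suc i" "set (c # q') \<inter> B \<noteq> {}"
      using assms(6) by (auto simp: cut_at_def)
    have "r = q' @ r'"
      using distinct_append_Cons_eq[of "p @ d # q" c r p' "q' @ r'"] 1(1) c(1) assms(1)
      by (auto simp: strand_def)
    then have "xs = p @ d # (q @ c # q') @ r'" using 1 by simp
    moreover have "\<forall>z\<in>set (q @ c # q'). h z < Suc i" using 1 c assms(4) by auto
    moreover have "set (d # q @ c # q') \<inter> B \<noteq> {}" using c(3) by auto
    ultimately show ?thesis unfolding cut_at_def by blast
  next
    case 2
    have "set xs \<inter> B \<noteq> {}" using assms(6) by (auto simp: cut_at_def)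
    then have "last xs \<in> B" using assms(1) 2 by (auto simp: strand_def)
    then have "last (d # q) \<in> B" using 2(2) by simp
    then have "set (d # q) \<inter> B \<noteq> {}" by (metis IntI empty_iff last_in_set list.distinct(1))
    then show ?thesis unfolding cut_at_def using 2 by (intro exI[of _ p] exI[of _ q] exI[of _ "[]"]) auto
  qed
qed

lemma Cut_cut_at:
  assumes "strand cyc xs"
  shows "u \<in> Cut \<Longrightarrow> fst u \<in> set xs \<Longrightarrow> cut_at xs (snd u) (fst u)"
proof (induction rule: Cut.induct)
  case (start v)
  then obtain p r where "v = (fst v, 1)" "fst v \<in> B" "xs = p @ fst v # r" by (auto simp: starts_def dest: split_list)
  then show ?case unfolding cut_at_def by (intro exI[of _ p] exI[of _ "[]"] exI[of _ r]) auto
next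
  case (climb u c p)
  have uN: "u \<in> nodes" using climb Cut_N by blast
  \<comment> \<open>The level is raised before walking: the nodes left behind belong to elements of
    height exactly \<open>snd u\<close>, which only a stretch for the next level may
    contain.\<close>
  have *: "cut_at xs (Suc (snd u)) (fst c)" if "fst c \<in> set xs"
    using climb.hyps(2) that
  proof (induction rule: rtranclp_induct)
    case base
    then have "cut_at xs (snd u) (fst u)" using climb.IH by blast
    then show ?case unfolding cut_at_def by (metis less_Suc_eq)
  next
    case (step y z)
    have y: "y \<in> nodes" "snd y = snd u" using hops_N[OF step.hyps(1) uN] by auto
    have yx: "fst y \<in> set xs" using strand_hop_back[OF assms y(1) step.hyps(2) step.prems] .
    have z: "up m y = None" "left m y = Some z" using step.hyps(2) by (auto simp: hop_def)
    have "snd z = snd u" using left_N[OF y(1) z(2)] y(2) by simp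
    then have "left m (fst y, snd u) = Some (fst z, snd u)" using z(2) y(2) by (metis prod.collapse)
    moreover have "snd u = h (fst y)" using y z(1) up_eq[of "fst y" "snd y"]
      by (cases y) (auto simp: nodes_iff split: if_splits)
    moreover have "1 \<le> snd u" using uN by (simp add: nodes_iff)
    ultimately show ?case using cut_at_left[OF assms yx _ _ _ step.IH[OF yx]] by blast
  qed
  have "c \<in> nodes" "snd c = snd u" using hops_N[OF climb.hyps(2) uN] by auto
  then have "p = (fst c, Suc (snd u))"
    using climb.hyps(3) up_eq[of "fst c" "snd c"] by (cases c) (auto simp: nodes_iff split: if_splits)
  then show ?case using * climb.prems by simp
qed

section \<open>The final memory links exactly the broken sequences\<close>

lemma cut_memory_simps:
  "right cut_memory u = (if u \<in> Cut then None else right m u)"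
  "left cut_memory w = (if \<exists>u\<in>Cut. right m u = Some w then None else left m w)"
  "up cut_memory = up m" "down cut_memory = down m"
  by (auto simp: cut_memory_def)

lemma cut_memory_left:
  assumes "w \<in> nodes" "left m w = Some u" "u \<notin> Cut"
  shows "left cut_memory w = Some u"
  using assms right_N Cut_N unfolding cut_memory_simps by (metis option.inject)

text \<open>A link inside a block passes over no element of \<open>B\<close> and survives. A link
  across the border of a block passes over the last element of a block, which is in
  \<open>B\<close>, and is cut.\<close>

lemma block_linked:
  assumes s: "strand cyc xs" "cyc \<longrightarrow> last xs \<in> B" and blk: "blk \<in> set (chop B xs)" and i: "1 \<le> i"
  shows "linked_linear cut_memory (level_nodes h i blk)"
proof -
  obtain ys zs where b: "xs = ys @ blk @ zs" "ys = [] \<or> last ys \<in> B"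
    "zs = [] \<or> last blk \<in> B" "set (butlast blk) \<inter> B = {}"
    using chop_block[OF blk] by blast
  have dist: "distinct xs" and el: "set xs \<subseteq> elements L" using s by (auto simp: strand_def)
  have "right cut_memory u = Some w \<and> left cut_memory w = Some u"
    if adj: "level_nodes h i blk = P @ u # w # Q" for P u w Q
  proof -
    obtain p d q c r where n: "blk = p @ d # q @ c # r" "\<forall>z\<in>set q. h z < i" "i \<le> h d" "i \<le> h c"
      "u = (d, i)" "w = (c, i)" using level_nodes_adjacent[OF adj] by blast
    have xs: "xs = (ys @ p) @ d # q @ c # (r @ zs)" using b n by simp
    have lnk: "right m u = Some w \<and> left m w = Some u"
      using strand_adjacent[OF s(1) i xs] n by simp
    have "u \<notin> Cut"
    proof
      assume "u \<in> Cut"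
      then have "cut_at xs i d" using Cut_cut_at[OF s(1), of u] n xs by simp
      then obtain p' q' r' where c: "xs = p' @ d # q' @ r'" "\<forall>z\<in>set q'. h z < i" "set (d # q') \<inter> B \<noteq> {}"
        by (auto simp: cut_at_def)
      have "q @ c # r @ zs = q' @ r'"
        using distinct_append_Cons_eq[of "ys @ p" d "q @ c # r @ zs" p' "q' @ r'"] xs c(1) dist by simp
      \<comment> \<open>The element \<open>c\<close> is too tall to belong to \<open>q'\<close>, so
        \<open>q'\<close> ends before it.\<close>
      then have "set q' \<subseteq> set q"
        using c(2) n(4) by (fastforce simp: append_eq_append_conv2 append_eq_Cons_conv Cons_eq_append_conv)
      moreover have "set (d # q) \<subseteq> set (butlast blk)" using n(1) by (auto simp: butlast_append)
      ultimately show False using b(4) c(3) by auto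
    qed
    moreover have "w \<in> nodes" using n xs el i by (auto simp: nodes_iff)
    ultimately show ?thesis using lnk cut_memory_left by (simp add: cut_memory_simps(1))
  qed
  moreover have "right cut_memory (last (level_nodes h i blk)) = None" if ne: "level_nodes h i blk \<noteq> []"
  proof -
    have "level_nodes h i blk = butlast (level_nodes h i blk) @ [last (level_nodes h i blk)]" using ne by simp
    from level_nodes_last[OF this] obtain p d q where n: "blk = p @ d # q" "\<forall>z\<in>set q. h z < i" "i \<le> h d"
      "last (level_nodes h i blk) = (d, i)" by blast
    show ?thesis
    proof (cases "last blk \<in> B")
      case True
      then have "last (d # q) \<in> B" using n by simp
      then have "set (d # q) \<inter> B \<noteq> {}" by (metis IntI empty_iff last_in_set list.distinct(1))
      moreover have "xs = (ys @ p) @ d # q @ zs" using b n by simp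
      ultimately have "cut_at xs i d" unfolding cut_at_def using n(2) by blast
      then have "(d, i) \<in> Cut" using cut_at_Cut[OF s(1) i] n by blast
      then show ?thesis using n by (simp add: cut_memory_simps)
    next
      case False
      then have "zs = []" using b by blast
      moreover have "last xs = last blk" using b(1) n(1) \<open>zs = []\<close> by simp
      \<comment> \<open>A cyclic strand that is chopped ends in \<open>B\<close>; here the block is
        the tail of a linear strand, whose last right pointer was null from the beginning.\<close>
      ultimately have "\<not> cyc" using False s by auto
      then have lin: "linked_linear m (level_nodes h i xs)" using s(1) i by (auto simp: strand_def)
      have "level_nodes h i xs = level_nodes h i (ys @ p) @ [(d, i)]" using b n \<open>zs = []\<close> by simp
      then have "right m (d, i) = None" using lin by (auto simp: linked_linear_iff)
      then show ?thesis using n by (simp add: cut_memory_simps)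
    qed
  qed
  moreover have "left cut_memory (hd (level_nodes h i blk)) = None" if ne: "level_nodes h i blk \<noteq> []"
  proof -
    have "level_nodes h i blk = hd (level_nodes h i blk) # tl (level_nodes h i blk)" using ne by simp
    from level_nodes_eq_Cons[OF this] obtain q c r where n: "blk = q @ c # r" "\<forall>z\<in>set q. h z < i" "i \<le> h c"
      "hd (level_nodes h i blk) = (c, i)" by blast
    have xs: "xs = (ys @ q) @ c # (r @ zs)" using b n by simp
    show ?thesis
    proof (cases "left m (c, i)")
      case None
      then show ?thesis using n by (simp add: cut_memory_simps)
    next
      case (Some e)
      have cx: "c \<in> set xs" using xs by simp
      obtain d where d: "e = (d, i)" "i \<le> h d" "(\<exists>p q r. xs = p @ d # q @ c # r \<and> (\<forall>z\<in>set q. h z < i)) \<or>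
        cyc \<and> (\<exists>p q. xs = p @ d # q \<and> (\<forall>z\<in>set q. h z < i))"
        using strand_left[OF s(1) cx i n(3) Some] by blast
      have "cut_at xs i d" using d(3)
      proof
        assume "\<exists>p q r. xs = p @ d # q @ c # r \<and> (\<forall>z\<in>set q. h z < i)"
        then obtain p' q' r' where e: "xs = (p' @ d # q') @ c # r'" "\<forall>z\<in>set q'. h z < i" by auto
        then have eq: "ys @ q = p' @ d # q'"
          using distinct_append_Cons_eq[of "ys @ q" c "r @ zs" "p' @ d # q'" r'] xs dist by simp
        \<comment> \<open>Being of height at least \<open>i\<close>, the predecessor
          \<open>d\<close> lies in an earlier block, so the last element of \<open>ys\<close>, which
          is in \<open>B\<close>, comes at or after \<open>d\<close> and before
          \<open>c\<close>.\<close>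
        have "d \<notin> set q" using n(2) d(2) by auto
        then obtain q2 where ys: "ys = p' @ d # q2" "q' = q2 @ q"
          using eq by (auto simp: append_eq_append_conv2 append_eq_Cons_conv Cons_eq_append_conv)
        then have "last (d # q2) \<in> B" using b(2) by auto
        then have "set (d # q') \<inter> B \<noteq> {}" using ys(2)
          by (metis IntI Un_iff append_Cons empty_iff last_in_set list.distinct(1) set_append)
        moreover have "xs = p' @ d # q' @ (c # r')" using e by simp
        ultimately show ?thesis unfolding cut_at_def using e(2) by blast
      next
        assume "cyc \<and> (\<exists>p q. xs = p @ d # q \<and> (\<forall>z\<in>set q. h z < i))"
        then obtain p' q' where e: "xs = p' @ d # q'" "\<forall>z\<in>set q'. h z < i" cyc by blast
        then have "last (d # q') \<in> B" using s(2) by simp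
        then have "set (d # q') \<inter> B \<noteq> {}" by (metis IntI empty_iff last_in_set list.distinct(1))
        then show ?thesis unfolding cut_at_def using e
          by (intro exI[of _ p'] exI[of _ q'] exI[of _ "[]"]) auto
      qed
      then have "(d, i) \<in> Cut" using cut_at_Cut[OF s(1) i] d by blast
      moreover have "(c, i) \<in> nodes" using cx el i n by (auto simp: nodes_iff)
      then have "right m (d, i) = Some (c, i)" using left_N Some d by blast
      ultimately show ?thesis using n(4) by (auto simp: cut_memory_simps)
    qed
  qed
  ultimately show ?thesis unfolding linked_linear_iff by blast
qed

lemma unbroken_cycle_linked:
  assumes s: "strand True xs" "set xs \<inter> B = {}" and i: "1 \<le> i"
  shows "linked_cyclic cut_memory (level_nodes h i xs)"
proof -
  let ?ns = "level_nodes h i xs"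
  have lnk: "linked_cyclic m ?ns" using s i by (simp add: strand_def)
  have nc: "u \<notin> Cut" "u \<in> nodes" if u: "u \<in> set ?ns" for u
  proof -
    have "fst u \<in> set xs" using u by (auto simp: level_nodes_def)
    then show "u \<notin> Cut" using Cut_cut_at[OF s(1)] s(2) by (fastforce simp: cut_at_def)
    show "u \<in> nodes" using u i s(1) by (auto simp: level_nodes_def strand_def nodes_iff)
  qed
  show ?thesis unfolding linked_cyclic_def
  proof (intro allI impI)
    fix k assume k: "k < length ?ns"
    then have k': "Suc k mod length ?ns < length ?ns" by (intro mod_less_divisor) linarith
    have "right m (?ns ! k) = Some (?ns ! (Suc k mod length ?ns))"
      "left m (?ns ! (Suc k mod length ?ns)) = Some (?ns ! k)"
      using lnk k by (auto simp: linked_cyclic_def)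
    then show "right cut_memory (?ns ! k) = Some (?ns ! (Suc k mod length ?ns)) \<and>
      left cut_memory (?ns ! (Suc k mod length ?ns)) = Some (?ns ! k)"
      using nc[OF nth_mem[OF k]] nc[OF nth_mem[OF k']] cut_memory_left by (simp add: cut_memory_simps(1))
  qed
qed

lemma valid_cut_memory: "valid_skip_list h (break_after B L) cut_memory"
proof -
  note v = valid[unfolded valid_skip_list_def]
  have el: "elements (break_after B L) \<subseteq> elements L"
    using break_seq_subset by (fastforce simp: elements_def break_after_def)
  have "finite (break_after B L)"
    using v unfolding break_after_def by (auto simp: break_seq_opened)
  moreover have "\<forall>s\<in>break_after B L. distinct (seq_list s)"
    using v break_seq_distinct(1) unfolding break_after_def by blast
  moreover have "set (seq_list s1) \<inter> set (seq_list s2) = {}"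
    if s: "s1 \<in> break_after B L" "s2 \<in> break_after B L" "s1 \<noteq> s2" for s1 s2
  proof -
    obtain r1 r2 where r: "r1 \<in> L" "s1 \<in> break_seq B r1" "r2 \<in> L" "s2 \<in> break_seq B r2"
      using s by (auto simp: break_after_def)
    show ?thesis
    proof (cases "r1 = r2")
      case True
      then show ?thesis using break_seq_distinct(2) r s(3) v by metis
    next
      case False
      then have "set (seq_list r1) \<inter> set (seq_list r2) = {}" using v r by blast
      then show ?thesis using break_seq_subset r by blast
    qed
  qed
  moreover have "linked_at_level h cut_memory i s'" if "s' \<in> break_after B L" "1 \<le> i" for s' i
  proof -
    note s' = that
    obtain s where s: "s \<in> L" "s' \<in> break_seq B s" using s'(1) by (auto simp: break_after_def)
    note str = strand_opened[OF s(1)]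
    show ?thesis
    proof (cases "is_cyclic s \<and> set (seq_list s) \<inter> B = {}")
      case True
      then obtain xs where "s = Cyclic xs" by (cases s) auto
      then show ?thesis using unbroken_cycle_linked[of xs i] str True s(2) that(2)
        by (simp add: break_seq_opened)
    next
      case False
      then have "is_cyclic s \<longrightarrow> last (opened B s) \<in> B" using str by (auto simp: strand_def)
      moreover obtain blk where "blk \<in> set (chop B (opened B s))" "s' = Linear blk"
        using s(2) False by (auto simp: break_seq_opened split: if_splits)
      ultimately show ?thesis using block_linked[OF str _ _ that(2)] by simp
    qed
  qed
  ultimately show ?thesis
    unfolding valid_skip_list_def cut_memory_simps using v el by blast
qed

end

text \<open>Termination needs no fairness: no schedule is infinite, and a configuration without a
  step has only returned calls. The equivalence in \<open>m''\<close> asserts both existence and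
  uniqueness of the sequential result, for every order of \<open>B\<close>.\<close>

theorem theorem2:
  fixes h :: "'a \<Rightarrow> nat" and L :: "'a seq set" and m :: "'a node mem" and B :: "'a set"
  assumes "valid_skip_list h L m"
    and "B \<subseteq> elements L"
  shows "\<not> (\<exists>c :: nat \<Rightarrow> 'a node config.
            c 0 = initial ((\<lambda>x. (x, 1)) ` B) m \<and> (\<forall>n. conc_step (c n) (c (Suc n)))) \<and>
         (\<forall>T m'. conc_step\<^sup>*\<^sup>* (initial ((\<lambda>x. (x, 1)) ` B) m) (T, m') \<and>
                  \<not> (\<exists>c. conc_step (T, m') c) \<longrightarrow>
            (\<forall>v. T v = Returned) \<and>
            (\<forall>bs. distinct bs \<and> set bs = B \<longrightarrow>
               (\<forall>m''. sequential_result (map (\<lambda>x. (x, 1)) bs) m m'' \<longleftrightarrow> m'' = m')) \<and>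
            valid_skip_list h (break_after B L) m')"
proof -
  interpret skip_list_split h L m B using assms by unfold_locales
  have "(\<forall>v. T v = Returned) \<and>
      (\<forall>bs. distinct bs \<and> set bs = B \<longrightarrow>
         (\<forall>m''. sequential_result (map (\<lambda>x. (x, 1)) bs) m m'' \<longleftrightarrow> m'' = m')) \<and>
      valid_skip_list h (break_after B L) m'"
    if run: "conc_step\<^sup>*\<^sup>* (initial ((\<lambda>x. (x, 1)) ` B) m) (T, m')"
      and stuck: "\<not> (\<exists>c. conc_step (T, m') c)" for T m'
  proof -
    have ret: "T v = Returned" for v using stuck_all_returned[OF stuck] .
    then have "m' = cut_memory"
      using finished_memory[OF invariant_steps[OF run[folded starts_def] invariant_initial]] by blast
    moreover have "sequential_result (map (\<lambda>x. (x, 1)) bs) m m'' \<longleftrightarrow> m'' = cut_memory"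
      if "distinct bs" "set bs = B" for bs m''
      using that by (intro sequential_result_iff) (auto simp: distinct_map inj_on_def starts_def)
    ultimately show ?thesis using ret valid_cut_memory by blast
  qed
  then show ?thesis using no_infinite_run[unfolded starts_def] by blast
qed

end
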